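(* Let $k$ be a field of characteristic different from $2$, let $q \in k\setminus\{0\}$ with $q \neq 1$, and let $u = (q-1)xy + 1$ in the quantized Weyl algebra $\mathcal{A}_1^q(k)$. 1. If $q$ is not a root of unity, then an element of $\mathcal{A}_1^q(k)$ is prime if and only if it is a nonzero scalar multiple of $u$ (scalars being elements of $k$). 2. Suppose $P$ is an irreducible polynomial belonging to $k[x]$ or $k[y]$. If $P$ is central in $\mathcal{A}_1^q(k)$, then $P$ is prime in $\mathcal{A}_1^q(k)$. 3. Let $a,b,c,f \in k$ be arbitrary. (a) If $F = bxy + f$, then $F$ is prime in $\mathcal{A}_1^q(k)$ if and only if $F = fu$ and $f \neq 0$. (b) If $F = ax^2 + cy^2 + f$ and $q = -1$, then $F$ is prime in $\mathcal{A}_1^q(k)$ if and only if $F$ is irreducible in $\mathcal{A}_1^q(k)$.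
   Context: For $q \neq 1$, the quantized Weyl algebra is the Ore extension $\mathcal{A}_1^q(k) = k[x][y;\sigma,\delta]$, where $\sigma$ is the $k$-algebra automorphism of $k[x]$ with $\sigma(x) = qx$ and $\delta(P) = \dfrac{\sigma(P) - P}{(q-1)x}$ for $P \in k[x]$; that is, the $k$-algebra generated by $x,y$ subject to $yx = qxy + 1$. It is a domain with $k$-basis $\{x^iy^j\}$. In a domain $A$: an element $a$ is irreducible if it is not a unit and whenever $a = bc$ with $b,c \in A$, either $b$ or $c$ is a unit. We say $a$ divides $c$, written $a \mid c$, if there exists $b \in A$ with $c = ab$ or $c = ba$. A nonzero nonunit $a$ is prime if $a \mid bc$ implies $a \mid b$ or $a \mid c$ for all $b,c \in A$. *)

theory Defs
  imports "HOL-Computational_Algebra.Computational_Algebra" "HOL-Algebra.Ring"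
begin

text \<open>
  The Ore extension \<open>R[y; \<sigma>, \<delta>]\<close> of a commutative ring \<open>R\<close>. The polynomial with coefficients
  \<open>P\<^sub>0, P\<^sub>1, \<dots>\<close> stands for \<open>\<Sum>i. P\<^sub>i y\<^sup>i\<close>, coefficients on the left. Left
  multiplication by \<open>y\<close> is determined by the commutation rule \<open>y P = \<sigma>(P) y + \<delta>(P)\<close>.
\<close>

definition ore_y :: "('r \<Rightarrow> 'r) \<Rightarrow> ('r \<Rightarrow> 'r) \<Rightarrow> 'r::comm_ring_1 poly \<Rightarrow> 'r poly" where
  "ore_y \<sigma> \<delta> g = pCons 0 (map_poly \<sigma> g) + map_poly \<delta> g"

definition ore_mult :: "('r \<Rightarrow> 'r) \<Rightarrow> ('r \<Rightarrow> 'r) \<Rightarrow> 'r::comm_ring_1 poly \<Rightarrow> 'r poly \<Rightarrow> 'r poly" where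
  "ore_mult \<sigma> \<delta> f g = (\<Sum>i\<le>degree f. smult (coeff f i) ((ore_y \<sigma> \<delta> ^^ i) g))"

definition ore_ext :: "('r \<Rightarrow> 'r) \<Rightarrow> ('r \<Rightarrow> 'r) \<Rightarrow> 'r::comm_ring_1 poly ring" where
  "ore_ext \<sigma> \<delta> = \<lparr>carrier = UNIV, mult = ore_mult \<sigma> \<delta>, one = 1, zero = 0, add = (+)\<rparr>"

definition qsigma :: "'k::field \<Rightarrow> 'k poly \<Rightarrow> 'k poly" where
  "qsigma q P = pcompose P [:0, q:]"

text \<open>The division below is exact, and the divisor is nonzero when \<open>q \<noteq> 1\<close>.\<close>

definition qdelta :: "'k::field \<Rightarrow> 'k poly \<Rightarrow> 'k poly" where
  "qdelta q P = (qsigma q P - P) div [:0, q - 1:]"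

definition qweyl :: "'k::field \<Rightarrow> 'k poly poly ring" where
  "qweyl q = ore_ext (qsigma q) (qdelta q)"

definition qw_of_x :: "'k::field poly \<Rightarrow> 'k poly poly" where
  "qw_of_x P = [:P:]"

definition qw_of_y :: "'k::field poly \<Rightarrow> 'k poly poly" where
  "qw_of_y P = map_poly (\<lambda>c. [:c:]) P"

definition qw_const :: "'k::field \<Rightarrow> 'k poly poly" where
  "qw_const c = [:[:c:]:]"

definition qw_x :: "'k::field poly poly" where
  "qw_x = qw_of_x [:0, 1:]"

definition qw_y :: "'k::field poly poly" where
  "qw_y = qw_of_y [:0, 1:]"

definition qw_u :: "'k::field \<Rightarrow> 'k poly poly" where
  "qw_u q = qw_const (q - 1) \<otimes>\<^bsub>qweyl q\<^esub> (qw_x \<otimes>\<^bsub>qweyl q\<^esub> qw_y) \<oplus>\<^bsub>qweyl q\<^esub> \<one>\<^bsub>qweyl q\<^esub>"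

text \<open>
  The library's divisibility, irreducible and prime elements for monoids are one-sided notions meant
  for the commutative case; the following are the two-sided versions for noncommutative domains.
\<close>

definition nc_divides :: "('a, 'm) ring_scheme \<Rightarrow> 'a \<Rightarrow> 'a \<Rightarrow> bool" where
  "nc_divides A a c \<longleftrightarrow> (\<exists>b\<in>carrier A. c = a \<otimes>\<^bsub>A\<^esub> b \<or> c = b \<otimes>\<^bsub>A\<^esub> a)"

definition nc_irreducible :: "('a, 'm) ring_scheme \<Rightarrow> 'a \<Rightarrow> bool" where
  "nc_irreducible A a \<longleftrightarrow> a \<in> carrier A \<and> a \<notin> Units A \<and>
     (\<forall>b\<in>carrier A. \<forall>c\<in>carrier A. a = b \<otimes>\<^bsub>A\<^esub> c \<longrightarrow> b \<in> Units A \<or> c \<in> Units A)"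

definition nc_prime :: "('a, 'm) ring_scheme \<Rightarrow> 'a \<Rightarrow> bool" where
  "nc_prime A a \<longleftrightarrow> a \<in> carrier A \<and> a \<noteq> \<zero>\<^bsub>A\<^esub> \<and> a \<notin> Units A \<and>
     (\<forall>b\<in>carrier A. \<forall>c\<in>carrier A.
        nc_divides A a (b \<otimes>\<^bsub>A\<^esub> c) \<longrightarrow> nc_divides A a b \<or> nc_divides A a c)"

definition nc_central :: "('a, 'm) ring_scheme \<Rightarrow> 'a \<Rightarrow> bool" where
  "nc_central A a \<longleftrightarrow> a \<in> carrier A \<and> (\<forall>b\<in>carrier A. a \<otimes>\<^bsub>A\<^esub> b = b \<otimes>\<^bsub>A\<^esub> a)"

lemma ore_mult_bound:
  assumes "degree f \<le> n"
  shows "ore_mult \<sigma> \<delta> f g = (\<Sum>i\<le>n. smult (coeff f i) ((ore_y \<sigma> \<delta> ^^ i) g))"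
  unfolding ore_mult_def
  by (rule sum.mono_neutral_left) (use assms in \<open>auto simp: coeff_eq_0\<close>)

locale ore_data =
  fixes \<sigma> \<delta> :: "'r::comm_ring_1 \<Rightarrow> 'r"
  assumes \<sigma>_add: "\<sigma> (a + b) = \<sigma> a + \<sigma> b"
    and \<sigma>_mult: "\<sigma> (a * b) = \<sigma> a * \<sigma> b"
    and \<sigma>_1: "\<sigma> 1 = 1"
    and \<delta>_add: "\<delta> (a + b) = \<delta> a + \<delta> b"
    and \<delta>_mult: "\<delta> (a * b) = \<sigma> a * \<delta> b + \<delta> a * b"
begin

abbreviation "Y \<equiv> ore_y \<sigma> \<delta>"
abbreviation "M \<equiv> ore_mult \<sigma> \<delta>"

lemma smult_sum_right: "smult a (sum f A) = (\<Sum>i\<in>A. smult a (f i :: 'r poly))"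
  by (induction A rule: infinite_finite_induct) (simp_all add: smult_add_right)

lemma \<sigma>_0: "\<sigma> 0 = 0" using \<sigma>_add[of 0 0] by simp
lemma \<delta>_0: "\<delta> 0 = 0" using \<delta>_add[of 0 0] by simp
lemma \<delta>_1: "\<delta> 1 = 0" using \<delta>_mult[of 1 1] by (simp add: \<sigma>_1)

lemma coeff_Y: "coeff (Y g) n = (case n of 0 \<Rightarrow> 0 | Suc m \<Rightarrow> \<sigma> (coeff g m)) + \<delta> (coeff g n)"
  by (auto simp: ore_y_def coeff_pCons coeff_map_poly \<sigma>_0 \<delta>_0 split: nat.split)

lemma Y_add: "Y (f + g) = Y f + Y g"
  by (rule poly_eqI) (simp add: coeff_Y \<sigma>_add \<delta>_add split: nat.split)

lemma Y_0: "Y 0 = 0" using Y_add[of 0 0] by simp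

lemma Y_smult: "Y (smult a g) = smult (\<sigma> a) (Y g) + smult (\<delta> a) g"
  by (rule poly_eqI) (simp add: coeff_Y \<sigma>_mult \<delta>_mult algebra_simps split: nat.split)

lemma Yn_add: "(Y ^^ n) (f + g) = (Y ^^ n) f + (Y ^^ n) g"
  by (induction n) (simp_all add: Y_add)

lemma Y_sum: "Y (sum f A) = (\<Sum>i\<in>A. Y (f i))"
  by (induction A rule: infinite_finite_induct) (simp_all add: Y_add Y_0)

lemma M_add_right: "M f (g + h) = M f g + M f h"
  by (simp add: ore_mult_def Yn_add smult_add_right sum.distrib)

lemma M_add_left: "M (f + g) h = M f h + M g h"
proof -
  define n where "n = max (degree f) (degree g)"
  have "degree f \<le> n" "degree g \<le> n" "degree (f + g) \<le> n"
    by (auto simp: n_def degree_add_le_max)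
  then show ?thesis
    by (simp add: ore_mult_bound[where n = n] smult_add_left sum.distrib)
qed

lemma M_0_left: "M 0 g = 0" by (simp add: ore_mult_def)

lemma M_sum_left: "M (sum f A) h = (\<Sum>i\<in>A. M (f i) h)"
  by (induction A rule: infinite_finite_induct) (simp_all add: M_add_left M_0_left)

lemma M_smult_left: "M (smult a f) h = smult a (M f h)"
proof -
  have "M (smult a f) h = (\<Sum>i\<le>degree f. smult (coeff (smult a f) i) ((Y ^^ i) h))"
    by (rule ore_mult_bound) (rule degree_smult_le)
  then show ?thesis by (simp add: ore_mult_def smult_sum_right)
qed

lemma M_Y_left: "M (Y g) h = Y (M g h)"
proof -
  let ?n = "degree g"
  have s: "degree (Y g) \<le> Suc ?n"
    by (rule degree_le) (auto simp: coeff_Y coeff_eq_0 \<sigma>_0 \<delta>_0 split: nat.split)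
  have "M (Y g) h = (\<Sum>i\<le>Suc ?n. smult (coeff (Y g) i) ((Y ^^ i) h))"
    using s by (rule ore_mult_bound)
  also have "\<dots> = (\<Sum>i\<le>Suc ?n. smult (case i of 0 \<Rightarrow> 0 | Suc m \<Rightarrow> \<sigma> (coeff g m)) ((Y ^^ i) h))
      + (\<Sum>i\<le>Suc ?n. smult (\<delta> (coeff g i)) ((Y ^^ i) h))"
    by (simp add: coeff_Y smult_add_left sum.distrib del: sum.atMost_Suc)
  also have "(\<Sum>i\<le>Suc ?n. smult (case i of 0 \<Rightarrow> 0 | Suc m \<Rightarrow> \<sigma> (coeff g m)) ((Y ^^ i) h))
      = (\<Sum>i\<le>?n. smult (\<sigma> (coeff g i)) (Y ((Y ^^ i) h)))"
    by (subst sum.atMost_Suc_shift) simp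
  also have "(\<Sum>i\<le>Suc ?n. smult (\<delta> (coeff g i)) ((Y ^^ i) h))
      = (\<Sum>i\<le>?n. smult (\<delta> (coeff g i)) ((Y ^^ i) h))"
    by (simp add: coeff_eq_0 \<delta>_0)
  finally show ?thesis
    by (simp add: ore_mult_def Y_sum Y_smult sum.distrib)
qed

lemma M_Yn_left: "M ((Y ^^ n) g) h = (Y ^^ n) (M g h)"
  by (induction n) (simp_all add: M_Y_left)

lemma M_assoc: "M (M f g) h = M f (M g h)"
proof -
  have "M (M f g) h = (\<Sum>i\<le>degree f. smult (coeff f i) (M ((Y ^^ i) g) h))"
    by (simp add: ore_mult_def[of \<sigma> \<delta> f g] M_sum_left M_smult_left)
  then show ?thesis by (simp add: M_Yn_left ore_mult_def[of \<sigma> \<delta> f "M g h"])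
qed

lemma Yn_1: "(Y ^^ n) 1 = monom 1 n"
proof (induction n)
  case (Suc n)
  have "Y (monom 1 n) = monom 1 (Suc n)"
    by (rule poly_eqI) (auto simp: coeff_Y \<sigma>_1 \<sigma>_0 \<delta>_1 \<delta>_0 split: nat.split)
  with Suc show ?case by simp
qed simp

lemma M_1_left: "M 1 g = g" by (simp add: ore_mult_def)

lemma M_1_right: "M f 1 = f"
  by (simp add: ore_mult_def Yn_1 smult_monom poly_as_sum_of_monoms)

lemma ring_ore_ext: "ring (ore_ext \<sigma> \<delta>)"
proof (rule ringI)
  show "abelian_group (ore_ext \<sigma> \<delta>)"
  proof (rule abelian_groupI)
    fix x :: "'r poly"
    show "\<exists>y\<in>carrier (ore_ext \<sigma> \<delta>). y \<oplus>\<^bsub>ore_ext \<sigma> \<delta>\<^esub> x = \<zero>\<^bsub>ore_ext \<sigma> \<delta>\<^esub>"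
      by (rule bexI[of _ "- x"]) (simp_all add: ore_ext_def)
  qed (simp_all add: ore_ext_def)
  show "monoid (ore_ext \<sigma> \<delta>)"
    by (rule monoidI) (simp_all add: ore_ext_def M_assoc M_1_left M_1_right)
qed (simp_all add: ore_ext_def M_add_left M_add_right)

end

lemma qdelta_exact:
  fixes q :: "'k::field"
  assumes "q \<noteq> 1"
  shows "[:0, q - 1:] * qdelta q P = qsigma q P - P"
proof -
  have "[:0, 1:] dvd qsigma q P - P"
    using poly_eq_0_iff_dvd[of "qsigma q P - P" 0] by (simp add: qsigma_def poly_pcompose)
  then have "smult (q - 1) [:0, 1:] dvd qsigma q P - P"
    using assms by (subst smult_dvd_iff) simp
  then have "[:0, q - 1:] dvd qsigma q P - P" by simp
  then show ?thesis unfolding qdelta_def by (rule dvd_mult_div_cancel)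
qed

lemma ore_data_qweyl:
  fixes q :: "'k::field"
  assumes "q \<noteq> 1"
  shows "ore_data (qsigma q) (qdelta q)"
proof
  let ?X = "[:0, q - 1:]"
  have nz: "?X \<noteq> 0" using assms by simp
  note ex = qdelta_exact[OF assms]
  fix a b :: "'k poly"
  show add: "qsigma q (a + b) = qsigma q a + qsigma q b"
    by (simp add: qsigma_def pcompose_add)
  show mult: "qsigma q (a * b) = qsigma q a * qsigma q b"
    by (simp add: qsigma_def pcompose_mult)
  show "qsigma q 1 = 1" by (simp add: qsigma_def one_pCons)
  have "?X * qdelta q (a + b) = ?X * (qdelta q a + qdelta q b)"
    by (simp only: distrib_left ex add) simp
  with nz show "qdelta q (a + b) = qdelta q a + qdelta q b"
    using mult_left_cancel by blast
  have "?X * (qsigma q a * qdelta q b + qdelta q a * b)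
      = qsigma q a * (?X * qdelta q b) + (?X * qdelta q a) * b"
    by (simp only: algebra_simps)
  also have "\<dots> = ?X * qdelta q (a * b)"
    by (simp only: ex mult) (simp only: algebra_simps)
  finally have "?X * qdelta q (a * b) = ?X * (qsigma q a * qdelta q b + qdelta q a * b)" ..
  with nz show "qdelta q (a * b) = qsigma q a * qdelta q b + qdelta q a * b"
    using mult_left_cancel by blast
qed

lemma ring_qweyl: "q \<noteq> 1 \<Longrightarrow> ring (qweyl q)"
  unfolding qweyl_def by (intro ore_data.ring_ore_ext ore_data_qweyl)

lemma qweyl_relation:
  fixes q :: "'k::field"
  assumes "q \<noteq> 1"
  shows "qw_y \<otimes>\<^bsub>qweyl q\<^esub> qw_x =
    qw_const q \<otimes>\<^bsub>qweyl q\<^esub> (qw_x \<otimes>\<^bsub>qweyl q\<^esub> qw_y) \<oplus>\<^bsub>qweyl q\<^esub> \<one>\<^bsub>qweyl q\<^esub>"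
proof -
  have s: "qsigma q [:0, 1:] = [:0, q:]" "qsigma q 1 = 1" "qsigma q 0 = 0"
    by (simp_all add: qsigma_def pcompose_pCons one_pCons)
  have "[:0, q - 1:] * qdelta q [:0, 1:] = [:0, q - 1:] * 1"
    by (simp only: qdelta_exact[OF assms] s) simp
  moreover have "[:0, q - 1:] \<noteq> 0" using assms by simp
  ultimately have d: "qdelta q [:0, 1:] = 1" using mult_left_cancel by blast
  have y: "qw_y = [:0, 1::'k poly:]"
    by (simp add: qw_y_def qw_of_y_def map_poly_pCons one_pCons)
  have "qdelta q 0 = 0" by (simp add: qdelta_def qsigma_def)
  moreover have "smult [:1:] p = p" for p :: "'k poly poly"
    by (simp flip: one_pCons)
  ultimately show ?thesis
    using s d assms
    by (simp add: qweyl_def ore_ext_def ore_mult_def y qw_x_def qw_of_x_def qw_const_def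
        ore_y_def map_poly_pCons one_pCons)
qed

end

theory Submission
  imports Defs
begin

text \<open>
  The element \<open>u\<close> is normal, and the quotient by it is the ring of Laurent polynomials in \<open>x\<close>, a
  domain; so its scalar multiples are prime. Conversely let \<open>F\<close> be prime of degree \<open>n > 0\<close> in
  \<open>y\<close>, and \<open>N = n + 1\<close>. Then \<open>F x^N = x G\<close> for some \<open>G\<close>, and primality with a comparison of
  leading terms gives \<open>F x^N = r x^N F\<close>, where \<open>r\<close> is a nontrivial power of \<open>q\<close>. The
  quotient by \<open>u\<close> is commutative, so if \<open>q\<close> is not a root of unity \<open>F\<close> vanishes there, that is,
  \<open>u\<close> divides \<open>F\<close>. The anti-automorphism exchanging \<open>x\<close> and \<open>y\<close> handles \<open>F\<close> in \<open>k[x]\<close>.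

  For \<open>q = -1\<close> the element \<open>F = a x^2 + c y^2 + f\<close> is central, and when \<open>a\<close> and \<open>c\<close> are
  nonzero the quotient by \<open>F\<close> is a quaternion order with elements \<open>P + Q y\<close>. Let \<open>\<sigma>\<close> be
  \<open>x \<mapsto> -x\<close>. The reduced norm of \<open>P + Q y\<close> vanishes iff \<open>c G \<sigma>(G) = E Q \<sigma>(Q)\<close>, where
  \<open>G = 2 x P + Q\<close> and \<open>E = 4 a x^4 + 4 f x^2 + c\<close>. Either \<open>E\<close> has a simple irreducible factor
  fixed by \<open>\<sigma>\<close> up to scalars, and descent shows that the quotient is a domain; or
  \<open>E = k h \<sigma>(h)\<close> with \<open>h = h0 + h1 x + h2 x^2\<close>, and then \<open>4 F\<close> is
  \<open>k (h2 x + 2 h0 y + h1) (h2 x + 2 h0 y - h1)\<close>.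
\<close>

section \<open>Coefficients and the exchange of variables\<close>

lemma carrier_qweyl [simp]: "carrier (qweyl q) = UNIV"
  and zero_qweyl [simp]: "\<zero>\<^bsub>qweyl q\<^esub> = 0"
  and one_qweyl [simp]: "\<one>\<^bsub>qweyl q\<^esub> = 1"
  and add_qweyl [simp]: "a \<oplus>\<^bsub>qweyl q\<^esub> b = a + b"
  and mult_qweyl [simp]: "a \<otimes>\<^bsub>qweyl q\<^esub> b = ore_mult (qsigma q) (qdelta q) a b"
  by (simp_all add: qweyl_def ore_ext_def)

lemma coeff_qsigma: "coeff (qsigma q P) n = q ^ n * coeff P n"
proof (induction P arbitrary: n)
  case 0
  show ?case by (simp add: qsigma_def)
next
  case (pCons a P)
  have "qsigma q (pCons a P) = pCons a (smult q (qsigma q P))"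
    by (simp add: qsigma_def pcompose_pCons)
  with pCons.IH show ?case
    by (cases n) simp_all
qed

lemma coeff_qdelta:
  fixes q :: "'k::field"
  assumes "q \<noteq> 1"
  shows "coeff (qdelta q P) n = (q ^ Suc n - 1) / (q - 1) * coeff P (Suc n)"
proof -
  have "coeff ([:0, q - 1:] * qdelta q P) (Suc n) = coeff (qsigma q P - P) (Suc n)"
    by (simp only: qdelta_exact[OF assms])
  then have "(q - 1) * coeff (qdelta q P) n = (q ^ Suc n - 1) * coeff P (Suc n)"
    by (simp add: coeff_qsigma algebra_simps)
  with assms show ?thesis
    by (simp add: nonzero_eq_divide_eq mult.commute)
qed

text \<open>Transposition of the coefficient array: \<open>x^i y^j\<close> goes to
  \<open>x^j y^i\<close>. Exchanging the generators while reversing products preserves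
  \<open>y x = q x y + 1\<close>, so this is the natural candidate for an anti-automorphism.\<close>

definition swap_poly :: "'a::comm_monoid_add poly poly \<Rightarrow> 'a poly poly" where
  "swap_poly F = (\<Sum>i\<le>degree F. map_poly (\<lambda>c. monom c i) (coeff F i))"

lemma coeff_swap_poly: "coeff (coeff (swap_poly F) j) i = coeff (coeff F i) j"
proof -
  have "coeff (coeff (swap_poly F) j) i
      = (\<Sum>l\<le>degree F. if l = i then coeff (coeff F l) j else 0)"
    by (simp add: swap_poly_def coeff_sum coeff_map_poly)
  also have "\<dots> = coeff (coeff F i) j"
    by (simp add: coeff_eq_0)
  finally show ?thesis .
qed

lemma poly_poly_eqI:
  assumes "\<And>i j. coeff (coeff F i) j = coeff (coeff G i) j"
  shows "F = G"
  by (intro poly_eqI assms)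

lemma swap_poly_swap_poly [simp]: "swap_poly (swap_poly F) = F"
  by (rule poly_poly_eqI) (simp add: coeff_swap_poly)

lemma swap_poly_add: "swap_poly (F + G) = swap_poly F + swap_poly G"
  by (rule poly_poly_eqI) (simp add: coeff_swap_poly)

lemma swap_poly_0 [simp]: "swap_poly 0 = 0"
  by (rule poly_poly_eqI) (simp add: coeff_swap_poly)

lemma swap_poly_eq_0_iff [simp]: "swap_poly F = 0 \<longleftrightarrow> F = 0"
  by (metis swap_poly_0 swap_poly_swap_poly)

lemma degree_pos_iff_nonunit:
  fixes P :: "'k::field poly"
  assumes "P \<noteq> 0"
  shows "degree P > 0 \<longleftrightarrow> \<not> is_unit P"
  using assms is_unit_iff_degree by auto

lemma exists_irreducible_factor:
  fixes P :: "'k::field poly"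
  assumes "degree P > 0"
  shows "\<exists>p. irreducible p \<and> p dvd P"
  using assms
proof (induction "degree P" arbitrary: P rule: less_induct)
  case less
  show ?case
  proof (cases "irreducible P")
    case False
    have "P \<noteq> 0" using less.prems by auto
    then obtain a b where ab: "P = a * b" "\<not> is_unit a" "\<not> is_unit b"
      using False less.prems degree_pos_iff_nonunit[of P] by (auto simp: irreducible_def)
    with \<open>P \<noteq> 0\<close> have "a \<noteq> 0" "b \<noteq> 0" by auto
    with ab have "degree a > 0" "degree a < degree P"
      by (simp_all add: degree_pos_iff_nonunit degree_mult_eq)
    then obtain p where "irreducible p" "p dvd a" using less.hyps by blast
    with ab show ?thesis by auto
  qed auto
qed

section \<open>Multiplication, units and primes\<close>

locale quantized_weyl =
  fixes q :: "'k::field"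
  assumes q_nonzero: "q \<noteq> 0" and q_neq_1: "q \<noteq> 1"
begin

sublocale ore_data "qsigma q" "qdelta q"
  by (rule ore_data_qweyl[OF q_neq_1])

abbreviation "s \<equiv> qsigma q"
abbreviation "d \<equiv> qdelta q"

lemma qsigma_const [simp]: "s [:c:] = [:c:]"
  by (simp add: qsigma_def)

lemma qdelta_const [simp]: "d [:c:] = 0"
  by (rule poly_eqI) (simp add: coeff_qdelta q_neq_1)

lemma qsigma_0 [simp]: "s 0 = 0" and qdelta_0 [simp]: "d 0 = 0"
  and qsigma_1 [simp]: "s 1 = 1" and qdelta_1 [simp]: "d 1 = 0"
  by (simp_all add: \<sigma>_0 \<delta>_0 \<sigma>_1 \<delta>_1)

lemma qsigma_minus: "s (- P) = - s P"
  by (rule poly_eqI) (simp add: coeff_qsigma)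

lemma qsigma_dvd_iff: "s P dvd s R \<longleftrightarrow> P dvd R"
proof
  \<comment> \<open>Here \<open>q \<noteq> 0\<close> enters: the substitution for
    \<open>inverse q\<close> undoes \<open>s\<close>.\<close>
  have inv: "qsigma (inverse q) (s T) = T" for T
    by (rule poly_eqI) (simp add: coeff_qsigma q_nonzero power_inverse)
  assume "s P dvd s R"
  then obtain T where "s R = s P * T" ..
  then have "qsigma (inverse q) (s R) = qsigma (inverse q) (s P) * qsigma (inverse q) T"
    by (simp add: qsigma_def pcompose_mult)
  then show "P dvd R" by (simp add: inv)
next
  assume "P dvd R"
  then show "s P dvd s R" by (auto simp: \<sigma>_mult)
qed

lemma qsigma_eq_0_iff [simp]: "s P = 0 \<longleftrightarrow> P = 0"
  using qsigma_dvd_iff[of 0 P] by simp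

lemma funpow_qsigma_const [simp]: "(s ^^ n) [:c:] = [:c:]"
  by (induction n) simp_all

lemma coeff_funpow_qsigma: "coeff ((s ^^ m) P) n = q ^ (m * n) * coeff P n"
  by (induction m) (simp_all add: coeff_qsigma power_add mult_ac)

lemma qsigma_inj: "(s ^^ m) P = (s ^^ m) R \<longleftrightarrow> P = R"
  by (auto simp: poly_eq_iff coeff_funpow_qsigma q_nonzero)

lemma funpow_Y_0 [simp]: "(Y ^^ n) 0 = 0"
  by (induction n) (simp_all add: Y_0)

lemma M_0_right [simp]: "M f 0 = 0"
  by (simp add: ore_mult_def)

lemma Y_pCons_0: "Y (pCons 0 g) = pCons 0 (Y g)"
  by (rule poly_eqI) (auto simp: coeff_Y coeff_pCons split: nat.split)

lemma Y_const: "Y [:P:] = [:d P, s P:]"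
  by (rule poly_eqI) (auto simp: coeff_Y coeff_pCons split: nat.split)

text \<open>\<open>pCons P f\<close> is \<open>P + f y\<close>, and \<open>Y g\<close> is
  \<open>y g\<close>. This recursion drives the later inductions on the left factor.\<close>

lemma M_pCons_left: "M (pCons P f) g = smult P g + M f (Y g)"
proof -
  have "M (pCons P f) g = (\<Sum>i\<le>Suc (degree f). smult (coeff (pCons P f) i) ((Y ^^ i) g))"
    by (rule ore_mult_bound) (simp add: degree_pCons_le)
  also have "\<dots> = smult P g + (\<Sum>i\<le>degree f. smult (coeff f i) ((Y ^^ i) (Y g)))"
    by (subst sum.atMost_Suc_shift) (simp add: funpow_swap1)
  finally show ?thesis by (simp add: ore_mult_def)
qed

text \<open>\<open>pCons 0 g\<close> is \<open>g y\<close>; with coefficients on the left, a factor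
  \<open>y\<close> at the far right has nothing to pass.\<close>

lemma M_pCons_0_right: "M f (pCons 0 g) = pCons 0 (M f g)"
proof (induction f arbitrary: g)
  case 0
  show ?case by (simp add: M_0_left)
next
  case (pCons P f)
  then show ?case by (simp add: M_pCons_left Y_pCons_0)
qed

lemma M_const_left [simp]: "M [:P:] g = smult P g"
  by (simp add: M_pCons_left M_0_left)

lemma M_scalar_right: "M f (smult [:c:] g) = smult [:c:] (M f g)"
proof (induction f arbitrary: g)
  case 0
  show ?case by (simp add: M_0_left)
next
  case (pCons P f)
  then show ?case by (simp add: M_pCons_left Y_smult smult_add_right mult.commute)
qed

text \<open>
  Leading terms are computed modulo a central polynomial \<open>P\<close>: the case \<open>P = 0\<close> yields the
  degree formula, and prime \<open>P\<close> yields that the quotient by \<open>P\<close> is a domain.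
\<close>

lemma funpow_Y_lead:
  assumes P: "s P = P" "d P = 0" and g: "\<And>j. j > n \<Longrightarrow> P dvd coeff g j"
  shows "(\<forall>j>i + n. P dvd coeff ((Y ^^ i) g) j) \<and> P dvd coeff ((Y ^^ i) g) (i + n) - (s ^^ i) (coeff g n)"
proof (induction i)
  case 0
  with g show ?case by simp
next
  case (Suc i)
  have sP: "P dvd s R" if "P dvd R" for R
    using that qsigma_dvd_iff[of P R] P by simp
  have dP: "P dvd d R" if "P dvd R" for R
    using that P by (auto simp: \<delta>_mult)
  have "P dvd coeff (Y ((Y ^^ i) g)) j" if "j > Suc i + n" for j
    using that Suc by (cases j) (auto simp: coeff_Y intro!: dvd_add sP dP)
  moreover have "P dvd coeff (Y ((Y ^^ i) g)) (Suc i + n) - (s ^^ Suc i) (coeff g n)"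
  proof -
    have "P dvd s (coeff ((Y ^^ i) g) (i + n) - (s ^^ i) (coeff g n))"
      using Suc by (intro sP) simp
    moreover have "s (A - B) = s A - s B" for A B
      using \<sigma>_add[of A "- B"] by (simp add: qsigma_minus)
    moreover have "P dvd d (coeff ((Y ^^ i) g) (Suc (i + n)))"
      using Suc by (intro dP) simp
    ultimately have "P dvd s (coeff ((Y ^^ i) g) (i + n)) - (s ^^ Suc i) (coeff g n)
        + d (coeff ((Y ^^ i) g) (Suc (i + n)))"
      by (intro dvd_add) simp_all
    then show ?thesis
      by (simp add: coeff_Y algebra_simps)
  qed
  ultimately show ?case by simp
qed

lemma coeff_M: "coeff (M f g) n = (\<Sum>i\<le>degree f. coeff f i * coeff ((Y ^^ i) g) n)"
  by (simp add: ore_mult_def coeff_sum)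

lemma M_lead:
  assumes P: "s P = P" "d P = 0"
    and f: "\<And>j. j > m \<Longrightarrow> P dvd coeff f j" and g: "\<And>j. j > n \<Longrightarrow> P dvd coeff g j"
  shows "P dvd coeff (M f g) (m + n) - coeff f m * (s ^^ m) (coeff g n)"
    and "j > m + n \<Longrightarrow> P dvd coeff (M f g) j"
proof -
  note Yg = funpow_Y_lead[OF P g]
  let ?t = "\<lambda>i. coeff f i * coeff ((Y ^^ i) g) (m + n) - (if i = m then coeff f m * (s ^^ m) (coeff g n) else 0)"
  have t: "P dvd ?t i" for i
  proof (cases i m rule: linorder_cases)
    case less
    with Yg[of n i] show ?thesis by auto
  next
    case equal
    with Yg[of n i] show ?thesis by (auto simp flip: right_diff_distrib)
  next
    case greater
    with f show ?thesis by auto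
  qed
  have "coeff (M f g) (m + n) - coeff f m * (s ^^ m) (coeff g n) = (\<Sum>i\<le>degree f. ?t i)"
    by (auto simp: sum_subtractf coeff_M not_le coeff_eq_0)
  with t show "P dvd coeff (M f g) (m + n) - coeff f m * (s ^^ m) (coeff g n)"
    by (simp only:) (intro dvd_sum)
  assume j: "j > m + n"
  have "P dvd coeff f i * coeff ((Y ^^ i) g) j" for i
  proof (cases "i > m")
    case True
    with f show ?thesis by simp
  next
    case False
    with j Yg[of n i] show ?thesis by simp
  qed
  then show "P dvd coeff (M f g) j"
    unfolding coeff_M by (intro dvd_sum)
qed

text \<open>The argument of Gauss's lemma: take the highest coefficients of \<open>f\<close> and of
  \<open>g\<close> not divisible by \<open>P\<close>. By \<open>M_lead\<close> their twisted product
  agrees modulo \<open>P\<close> with a coefficient of the product.\<close>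

lemma dvd_coeff_M:
  assumes P: "s P = P" "d P = 0" and pr: "\<And>a b. P dvd a * b \<Longrightarrow> P dvd a \<or> P dvd b"
    and M: "\<And>i. P dvd coeff (M f g) i"
  shows "(\<forall>i. P dvd coeff f i) \<or> (\<forall>i. P dvd coeff g i)"
proof (rule ccontr)
  have max: "\<exists>m. \<not> P dvd coeff h m \<and> (\<forall>j>m. P dvd coeff h j)" if "\<not> (\<forall>i. P dvd coeff h i)" for h
  proof -
    let ?S = "{i. \<not> P dvd coeff h i}"
    have "?S \<subseteq> {..degree h}"
      by (auto intro: le_degree)
    then have "finite ?S" by (rule finite_subset) simp
    moreover have "?S \<noteq> {}" using that by auto
    ultimately show ?thesis
      using Max_in[of ?S] Max_ge[of ?S] by (intro exI[of _ "Max ?S"]) (auto simp: not_le)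
  qed
  assume "\<not> ?thesis"
  then obtain m n where m: "\<not> P dvd coeff f m" "\<And>j. j > m \<Longrightarrow> P dvd coeff f j"
    and n: "\<not> P dvd coeff g n" "\<And>j. j > n \<Longrightarrow> P dvd coeff g j"
    using max by meson
  have "P dvd coeff f m * (s ^^ m) (coeff g n)"
    using dvd_diff[OF M[of "m + n"] M_lead(1)[OF P, of m f n g, OF m(2) n(2)]] by simp
  \<comment> \<open>Since \<open>s P = P\<close>, the twist by a power of \<open>s\<close> does not
    affect divisibility by \<open>P\<close>.\<close>
  moreover have "P dvd (s ^^ i) R \<longleftrightarrow> P dvd R" for i R
  proof (induction i)
    case (Suc i)
    then show ?case using qsigma_dvd_iff[of P "(s ^^ i) R"] P by simp
  qed simp
  ultimately show False using pr m(1) n(1) by blast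
qed

lemma M_eq_0_iff [simp]: "M f g = 0 \<longleftrightarrow> f = 0 \<or> g = 0"
proof
  assume "M f g = 0"
  then show "f = 0 \<or> g = 0"
    using dvd_coeff_M[of 0 f g] by (auto intro: poly_eqI)
qed (auto simp: M_0_left)

lemma lead_coeff_M: "coeff (M f g) (degree f + degree g) = lead_coeff f * (s ^^ degree f) (lead_coeff g)"
  using M_lead(1)[of 0 "degree f" f "degree g" g] by (simp add: coeff_eq_0)

lemma degree_M:
  assumes "f \<noteq> 0" "g \<noteq> 0"
  shows "degree (M f g) = degree f + degree g"
proof (rule antisym)
  show "degree (M f g) \<le> degree f + degree g"
    using M_lead(2)[of 0 "degree f" f "degree g" g] by (intro degree_le) (simp add: coeff_eq_0)
  have "(s ^^ degree f) (lead_coeff g) \<noteq> (s ^^ degree f) 0"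
    using assms by (simp only: qsigma_inj) simp
  moreover have "(s ^^ n) 0 = 0" for n
    by (induction n) simp_all
  ultimately have "coeff (M f g) (degree f + degree g) \<noteq> 0"
    using assms by (simp add: lead_coeff_M)
  then show "degree f + degree g \<le> degree (M f g)" by (rule le_degree)
qed

section \<open>Units, divisibility, and irreducibility of primes\<close>

abbreviation "A \<equiv> qweyl q"

lemma factors_of_scalar:
  assumes "M F G = [:[:e:]:]" "e \<noteq> 0"
  shows "\<exists>c. c \<noteq> 0 \<and> F = [:[:c:]:]" and "\<exists>c. c \<noteq> 0 \<and> G = [:[:c:]:]"
proof -
  have nz: "F \<noteq> 0" "G \<noteq> 0" using assms by (auto simp: M_0_left)
  with assms have "degree F = 0" "degree G = 0"
    using degree_M[OF nz] by simp_all
  then obtain P R where PR: "F = [:P:]" "G = [:R:]"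
    by (metis degree_eq_zeroE)
  with assms have e: "P * R = [:e:]" by simp
  moreover have "is_unit [:e:]" using assms(2) by (simp add: is_unit_const_poly_iff dvd_field_iff)
  ultimately have "is_unit P" "is_unit R" by (metis is_unit_mult_iff)+
  with PR show "\<exists>c. c \<noteq> 0 \<and> F = [:[:c:]:]" "\<exists>c. c \<noteq> 0 \<and> G = [:[:c:]:]"
    by (auto simp: is_unit_poly_iff)
qed

lemma Units_iff: "F \<in> Units A \<longleftrightarrow> (\<exists>c. c \<noteq> 0 \<and> F = [:[:c:]:])"
proof
  assume "F \<in> Units A"
  then obtain G where "M F G = [:[:1:]:]" by (auto simp: Units_def one_pCons)
  then show "\<exists>c. c \<noteq> 0 \<and> F = [:[:c:]:]" by (rule factors_of_scalar) simp
next
  assume "\<exists>c. c \<noteq> 0 \<and> F = [:[:c:]:]"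
  then obtain c where "c \<noteq> 0" "F = [:[:c:]:]" by auto
  then show "F \<in> Units A"
    by (auto simp: Units_def one_pCons intro!: exI[of _ "[:[:inverse c:]:]"])
qed

lemma unit_factors: "M F G \<in> Units A \<Longrightarrow> F \<in> Units A \<and> G \<in> Units A"
  by (auto simp: Units_iff intro: factors_of_scalar)

lemma nc_divides_iff: "nc_divides A F G \<longleftrightarrow> (\<exists>H. G = M F H \<or> G = M H F)"
  by (simp add: nc_divides_def)

text \<open>Additivity of degrees forces \<open>G\<close> and \<open>H\<close> into
  \<open>k[x]\<close>. Comparing leading coefficients gives \<open>P * (s ^^ n) R = 1\<close> with
  \<open>n = degree F\<close>, so both are nonzero scalars.\<close>

lemma unit_if_product_fixes:
  assumes "F \<noteq> 0" "F = M G (M F H)"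
  shows "G \<in> Units A \<and> H \<in> Units A"
proof -
  have nz: "G \<noteq> 0" "H \<noteq> 0" using assms by (auto simp: M_0_left)
  have "degree F = degree (M G (M F H))" using assms(2) by (rule arg_cong)
  then have "degree G = 0" "degree H = 0"
    using assms(1) nz by (simp_all add: degree_M)
  then obtain P R where PR: "G = [:P:]" "H = [:R:]"
    by (metis degree_eq_zeroE)
  let ?n = "degree F"
  have "lead_coeff F = P * coeff (M F [:R:]) ?n"
    using assms(2) PR by (metis M_const_left coeff_smult)
  also have "coeff (M F [:R:]) ?n = lead_coeff F * (s ^^ ?n) R"
    using lead_coeff_M[of F "[:R:]"] by simp
  finally have "lead_coeff F * 1 = lead_coeff F * (P * (s ^^ ?n) R)" by (simp add: mult_ac)
  then have PR1: "P * (s ^^ ?n) R = 1"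
    using assms(1) by (metis leading_coeff_0_iff mult_left_cancel)
  then have "is_unit P" "is_unit ((s ^^ ?n) R)" by (metis dvdI mult.commute)+
  then obtain a b where "a dvd 1" "b dvd 1" "P = [:a:]" "(s ^^ ?n) R = (s ^^ ?n) [:b:]"
    unfolding is_unit_poly_iff funpow_qsigma_const by blast
  then have "R = [:b:]" by (simp only: qsigma_inj)
  with \<open>a dvd 1\<close> \<open>b dvd 1\<close> \<open>P = [:a:]\<close> show ?thesis
    using PR by (auto simp: Units_iff)
qed

text \<open>\<open>F\<close> divides one of its own factors, on the left or on the right.
  Substituting this back exhibits \<open>F\<close> between two cofactors, to which
  \<open>unit_if_product_fixes\<close> applies.\<close>

lemma prime_factor_unit:
  assumes F: "nc_prime A F" and GH: "F = M G H"
  shows "G \<in> Units A \<or> H \<in> Units A"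
proof -
  have nz: "F \<noteq> 0" using F by (simp add: nc_prime_def)
  have "nc_divides A F (M G H)"
    unfolding nc_divides_iff using GH by (metis M_1_right)
  then have "nc_divides A F G \<or> nc_divides A F H"
    using F by (simp add: nc_prime_def)
  then consider K where "G = M F K" | K where "G = M K F" | K where "H = M F K" | K where "H = M K F"
    by (auto simp: nc_divides_iff)
  then show ?thesis
  proof cases
    case (1 K)
    then have "F = M 1 (M F (M K H))" using GH by (metis M_1_left M_assoc)
    then have "M K H \<in> Units A" using unit_if_product_fixes[OF nz] by blast
    then show ?thesis using unit_factors by blast
  next
    case (2 K)
    then have "F = M K (M F H)" using GH by (metis M_assoc)
    then show ?thesis using unit_if_product_fixes[OF nz] by blast
  next
    case (3 K)
    then have "F = M G (M F K)" using GH by simp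
    then show ?thesis using unit_if_product_fixes[OF nz] by blast
  next
    case (4 K)
    then have "F = M (M G K) (M F 1)" using GH by (metis M_1_right M_assoc)
    then have "M G K \<in> Units A" using unit_if_product_fixes[OF nz] by blast
    then show ?thesis using unit_factors by blast
  qed
qed

lemma prime_imp_irreducible: "nc_prime A F \<Longrightarrow> nc_irreducible A F"
  using prime_factor_unit[of F] unfolding nc_irreducible_def nc_prime_def mult_qweyl by blast

subsection \<open>The anti-automorphism exchanging the generators\<close>

abbreviation "x \<equiv> [:0, 1::'k:]"

lemma Y_x: "Y [:x:] = [:1, [:0, q:]:]"
  by (rule poly_poly_eqI)
    (auto simp: coeff_Y coeff_qsigma coeff_qdelta q_neq_1 coeff_pCons split: nat.split)

text \<open>Coefficientwise form of \<open>y^n x = q^n x y^n + [n] y^(n-1)\<close>, where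
  \<open>[n] = (q^n - 1) / (q - 1)\<close> is the q-integer.\<close>

lemma coeff_M_x:
  "coeff (M f [:x:]) n = coeff f n * [:0, q ^ n:] + smult ((q ^ Suc n - 1) / (q - 1)) (coeff f (Suc n))"
proof (induction f arbitrary: n)
  case 0
  show ?case by (simp add: M_0_left)
next
  case (pCons P f)
  have "[:1, [:0, q:]:] = 1 + smult [:q:] (pCons 0 [:x:])"
    by (simp add: one_pCons)
  then have M: "M (pCons P f) [:x:] = smult P [:x:] + (f + smult [:q:] (pCons 0 (M f [:x:])))"
    by (simp only: M_pCons_left Y_x M_add_right M_1_right M_scalar_right M_pCons_0_right)
  show ?case
  proof (cases n)
    case 0
    with M q_neq_1 show ?thesis by simp
  next
    case (Suc k)
    define b where "b = (q ^ Suc k - 1) / (q - 1)"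
    \<comment> \<open>The recursion \<open>[n + 1] = 1 + q [n]\<close> of the q-integers.\<close>
    have "(q ^ Suc n - 1) / (q - 1) = 1 + q * b"
      using q_neq_1 Suc by (simp add: b_def field_simps)
    moreover have "coeff (M (pCons P f) [:x:]) n
        = coeff f n + smult q (coeff f k * [:0, q ^ k:] + smult b (coeff f n))"
      using M Suc pCons.IH[of k] by (simp add: b_def)
    ultimately show ?thesis
      using Suc by (simp add: smult_add_left smult_add_right)
  qed
qed

text \<open>The same q-integers occur in \<open>d\<close> and in moving \<open>x\<close> leftwards
  past a power of \<open>y\<close>; hence the two arrays match entry by entry.\<close>

lemma swap_Y: "swap_poly (Y f) = M (swap_poly f) [:x:]"
  by (rule poly_poly_eqI)
    (auto simp: coeff_swap_poly coeff_Y coeff_qsigma coeff_qdelta q_neq_1 coeff_M_x coeff_pCons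
      split: nat.split)

lemma coeff_swap_const: "coeff (swap_poly [:P:]) n = [:coeff P n:]"
  by (rule poly_eqI) (auto simp: coeff_swap_poly coeff_pCons split: nat.split)

lemma swap_smult: "swap_poly (smult P f) = M (swap_poly f) (swap_poly [:P:])"
proof (induction P arbitrary: f)
  case 0
  show ?case by simp
next
  case (pCons c P)
  have "pCons c P = [:c:] + P * x" by simp
  then have "swap_poly (smult (pCons c P) f) = swap_poly (smult [:c:] f) + swap_poly (smult P (smult x f))"
    by (simp only: smult_add_left smult_smult swap_poly_add)
  moreover have "swap_poly (smult x f) = pCons 0 (swap_poly f)"
    by (rule poly_poly_eqI) (simp add: coeff_swap_poly coeff_pCons split: nat.split)
  moreover have "swap_poly (smult [:c:] f) = smult [:c:] (swap_poly f)"
    by (rule poly_poly_eqI) (simp add: coeff_swap_poly)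
  moreover have "swap_poly [:pCons c P:] = smult [:c:] 1 + Y (swap_poly [:P:])"
    by (rule poly_poly_eqI)
      (auto simp: coeff_swap_poly coeff_Y coeff_swap_const coeff_pCons one_pCons split: nat.split)
  ultimately show ?case
    by (simp only: pCons.IH M_add_right M_scalar_right M_1_right M_pCons_left) simp
qed

text \<open>A left factor is built from polynomials in \<open>x\<close> and from \<open>y\<close>;
  \<open>swap_smult\<close> and \<open>swap_Y\<close> treat these two kinds.\<close>

lemma swap_M: "swap_poly (M f g) = M (swap_poly g) (swap_poly f)"
proof (induction f arbitrary: g)
  case 0
  show ?case by (simp add: M_0_left)
next
  case (pCons P f)
  have "swap_poly (pCons P f) = swap_poly [:P:] + smult x (swap_poly f)"
    by (rule poly_poly_eqI) (auto simp: coeff_swap_poly coeff_pCons split: nat.split)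
  with pCons.IH show ?case
    by (simp add: M_pCons_left[of P] swap_poly_add swap_smult swap_Y M_add_right M_assoc)
qed

lemma swap_Units_iff: "swap_poly F \<in> Units A \<longleftrightarrow> F \<in> Units A"
proof -
  have const: "swap_poly [:[:c:]:] = [:[:c:]:]" for c :: 'k
    by (rule poly_poly_eqI) (auto simp: coeff_swap_poly coeff_pCons split: nat.split)
  then show ?thesis
    unfolding Units_iff by (metis swap_poly_swap_poly)
qed

lemma swap_divides_iff: "nc_divides A (swap_poly F) (swap_poly G) \<longleftrightarrow> nc_divides A F G"
  unfolding nc_divides_iff by (metis swap_M swap_poly_swap_poly)

lemma swap_prime:
  assumes "nc_prime A F"
  shows "nc_prime A (swap_poly F)"
proof -
  have "nc_divides A (swap_poly F) b \<or> nc_divides A (swap_poly F) c"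
    if "nc_divides A (swap_poly F) (M b c)" for b c
  proof -
    have "nc_divides A F (M (swap_poly c) (swap_poly b))"
      using that swap_divides_iff[of F "swap_poly (M b c)"] by (simp add: swap_M)
    then have "nc_divides A F (swap_poly b) \<or> nc_divides A F (swap_poly c)"
      using assms by (auto simp: nc_prime_def)
    then show ?thesis
      by (metis swap_divides_iff swap_poly_swap_poly)
  qed
  with assms show ?thesis
    by (auto simp: nc_prime_def swap_Units_iff)
qed

lemma swap_irreducible:
  assumes "nc_irreducible A F"
  shows "nc_irreducible A (swap_poly F)"
proof -
  have "b \<in> Units A \<or> c \<in> Units A" if "swap_poly F = M b c" for b c
  proof -
    have "F = M (swap_poly c) (swap_poly b)"
      by (metis that swap_M swap_poly_swap_poly)
    then have "swap_poly c \<in> Units A \<or> swap_poly b \<in> Units A"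
      using assms by (simp add: nc_irreducible_def)
    then show ?thesis by (auto simp: swap_Units_iff)
  qed
  with assms show ?thesis
    by (auto simp: nc_irreducible_def swap_Units_iff)
qed

subsection \<open>The normal element\<close>

abbreviation "u \<equiv> [:1, [:0, q - 1:]:]"

text \<open>
  Modulo \<open>u\<close> the generators commute and \<open>y = -1 / ((q - 1) x)\<close>, so the kernel of the following
  evaluation is the ideal generated by \<open>u\<close>.
\<close>

definition eval_u :: "'k poly poly \<Rightarrow> 'k poly fract" where
  "eval_u F = poly (map_poly to_fract F) (- inverse (to_fract [:0, q - 1:]))"

lemma to_fract_x_nonzero: "to_fract [:0, q - 1:] \<noteq> 0"
  using q_neq_1 by simp

lemma eval_u_0 [simp]: "eval_u 0 = 0"
  by (simp add: eval_u_def)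

lemma eval_u_add: "eval_u (F + G) = eval_u F + eval_u G"
proof -
  have "map_poly to_fract (F + G) = map_poly to_fract F + map_poly to_fract G"
    by (rule poly_eqI) (simp add: coeff_map_poly)
  then show ?thesis by (simp add: eval_u_def)
qed

lemma eval_u_smult: "eval_u (smult P F) = to_fract P * eval_u F"
proof -
  have "map_poly to_fract (smult P F) = smult (to_fract P) (map_poly to_fract F)"
    by (rule poly_eqI) (simp add: coeff_map_poly)
  then show ?thesis by (simp add: eval_u_def)
qed

lemma eval_u_pCons: "eval_u (pCons P F) = to_fract P - inverse (to_fract [:0, q - 1:]) * eval_u F"
  by (simp add: eval_u_def map_poly_pCons)

text \<open>At \<open>y = - 1 / ((q - 1) x)\<close> the expression \<open>s(P) y + d(P)\<close>
  collapses to \<open>P y\<close>, because \<open>s P - P = (q - 1) x d(P)\<close>. This is what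
  makes the evaluation multiplicative.\<close>

lemma eval_u_Y: "eval_u (Y F) = - inverse (to_fract [:0, q - 1:]) * eval_u F"
proof (induction F)
  case 0
  show ?case by (simp add: Y_0)
next
  case (pCons P F)
  have "Y (pCons P F) = [:d P, s P:] + pCons 0 (Y F)"
    by (rule poly_eqI) (auto simp: coeff_Y coeff_pCons split: nat.split)
  moreover have "to_fract (s P) = to_fract P + to_fract [:0, q - 1:] * to_fract (d P)"
    using qdelta_exact[OF q_neq_1, of P] by (simp flip: to_fract_mult to_fract_add)
  ultimately show ?case
    using to_fract_x_nonzero pCons.IH by (simp add: eval_u_add eval_u_pCons field_simps)
qed

lemma eval_u_M: "eval_u (M F G) = eval_u F * eval_u G"
proof (induction F arbitrary: G)
  case 0
  show ?case by (simp add: M_0_left)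
next
  case (pCons P F)
  then show ?case
    by (simp add: M_pCons_left eval_u_add eval_u_smult eval_u_pCons eval_u_Y algebra_simps)
qed

lemma eval_u_u: "eval_u u = 0"
  using to_fract_x_nonzero by (simp add: eval_u_pCons)

text \<open>Modulo \<open>(q - 1) x\<close>, only the term of degree \<open>n\<close> survives
  clearing denominators. So if \<open>F\<close> evaluates to zero, \<open>x\<close> divides its
  leading coefficient in \<open>y\<close>.\<close>

lemma eval_u_clear_denominator:
  assumes "degree F \<le> n"
  shows "\<exists>R. to_fract ([:0, q - 1:] ^ n) * eval_u F = to_fract ((- 1) ^ n * coeff F n + [:0, q - 1:] * R)"
  using assms
proof (induction F arbitrary: n)
  case 0
  show ?case by (intro exI[of _ 0]) simp
next
  case (pCons P F)
  show ?case
  proof (cases n)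
    case 0
    with pCons.prems have "F = 0" by (simp split: if_splits)
    with 0 show ?thesis by (intro exI[of _ 0]) (simp add: eval_u_pCons)
  next
    case (Suc m)
    with pCons.prems have "degree F \<le> m" by (simp split: if_splits)
    then obtain R where R: "to_fract ([:0, q - 1:] ^ m) * eval_u F
        = to_fract ((- 1) ^ m * coeff F m + [:0, q - 1:] * R)"
      using pCons.IH by blast
    have "to_fract ([:0, q - 1:] ^ n) * eval_u (pCons P F)
        = to_fract ([:0, q - 1:] ^ n * P) - to_fract ([:0, q - 1:] ^ m) * eval_u F"
      using to_fract_x_nonzero
      by (simp add: Suc eval_u_pCons right_diff_distrib del: mult_pCons_left)
    also have "\<dots> = to_fract ((- 1) ^ n * coeff (pCons P F) n + [:0, q - 1:] * ([:0, q - 1:] ^ m * P - R))"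
      by (simp only: R flip: to_fract_diff)
        (simp add: Suc algebra_simps del: mult_pCons_left mult_pCons_right)
    finally show ?thesis by blast
  qed
qed

text \<open>Division by \<open>u\<close>, whose leading coefficient \<open>(q - 1) x\<close> is not
  a unit. For \<open>F\<close> in the kernel it divides the leading coefficient of \<open>F\<close>,
  so the leading term can be cancelled and the rest stays in the kernel.\<close>

lemma eval_u_eq_0D: "eval_u F = 0 \<Longrightarrow> \<exists>H. F = M H u"
proof (induction "degree F" arbitrary: F rule: less_induct)
  case less
  show ?case
  proof (cases "degree F")
    case 0
    then obtain P where "F = [:P:]" by (metis degree_eq_zeroE)
    with less.prems have "F = M 0 u" by (simp add: eval_u_pCons M_0_left)
    then show ?thesis ..
  next
    case (Suc m)
    let ?n = "Suc m"
    obtain R where "to_fract ((- 1) ^ ?n * coeff F ?n + [:0, q - 1:] * R) = 0"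
      using eval_u_clear_denominator[of F ?n] less.prems Suc by auto
    then have "(- 1) ^ ?n * coeff F ?n + [:0, q - 1:] * R = 0"
      by (simp only: to_fract_eq_0_iff)
    then have "coeff F ?n = [:0, q - 1:] * ((- 1) ^ m * R)"
      unfolding add_eq_0_iff2 by (cases "even m") (simp_all del: mult_pCons_left)
    then obtain R where R: "coeff F ?n = [:0, q - 1:] * R" ..
    \<comment> \<open>The scalar compensates the factor \<open>q ^ m\<close> that
      \<open>(q - 1) x\<close> acquires on passing \<open>y^m\<close>.\<close>
    define G where "G = monom (smult (inverse (q ^ m)) R) m"
    have "R \<noteq> 0" using R Suc by (metis leading_coeff_0_iff mult_zero_right degree_0 nat.distinct(1))
    then have G: "degree G = m" "G \<noteq> 0" "lead_coeff G = smult (inverse (q ^ m)) R"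
      using q_nonzero by (simp_all add: G_def degree_monom_eq monom_eq_0_iff)
    have u: "degree u = 1" "lead_coeff u = [:0, q - 1:]" "u \<noteq> 0"
      using q_neq_1 by simp_all
    have "(s ^^ m) [:0, q - 1:] = smult (q ^ m) [:0, q - 1:]"
      by (rule poly_eqI) (auto simp: coeff_funpow_qsigma coeff_pCons split: nat.split)
    then have "coeff (M G u) ?n = smult (inverse (q ^ m)) R * smult (q ^ m) [:0, q - 1:]"
      using lead_coeff_M[of G u] G(3) u(2) by (simp only: G(1) u(1) flip: One_nat_def) simp
    then have lead: "coeff (M G u) ?n = coeff F ?n"
      using R q_nonzero by (simp add: mult.assoc mult.left_commute[of _ _ "inverse (q ^ m)"])
    have "degree (M G u) = ?n"
      using degree_M[of G u] G u by simp
    then have "degree (F - M G u) \<le> ?n"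
      using Suc by (intro degree_diff_le) simp_all
    moreover have "coeff (F - M G u) ?n = 0" using lead by simp
    ultimately have "degree (F - M G u) < degree F"
      using Suc by (metis degree_0 le_neq_implies_less leading_coeff_0_iff zero_less_Suc)
    moreover have "eval_u (F - M G u) = 0"
      using eval_u_add[of "F - M G u" "M G u"] less.prems by (simp add: eval_u_M eval_u_u)
    ultimately obtain H where "F - M G u = M H u" using less.hyps by blast
    then have "F = M (H + G) u" by (simp add: M_add_left algebra_simps)
    then show ?thesis ..
  qed
qed

text \<open>Divisibility by \<open>c u\<close>, on either side, amounts to lying in the kernel of
  \<open>eval_u\<close>, a multiplicative map into a field.\<close>

lemma prime_scalar_u:
  assumes "c \<noteq> 0"
  shows "nc_prime A (smult [:c:] u)"
proof -
  let ?F = "smult [:c:] u"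
  have eval: "eval_u ?F = 0" by (simp add: eval_u_smult eval_u_u del: smult_pCons)
  have div: "nc_divides A ?F G \<longleftrightarrow> eval_u G = 0" for G
  proof
    assume "nc_divides A ?F G"
    then show "eval_u G = 0"
      using eval by (auto simp: nc_divides_iff eval_u_M)
  next
    assume "eval_u G = 0"
    then obtain H where "G = M H u" using eval_u_eq_0D by blast
    moreover have "smult [:inverse c:] (smult [:c:] K) = K" for K :: "'k poly poly"
      using assms by (simp flip: one_pCons)
    ultimately have "G = M (smult [:inverse c:] H) ?F"
      by (simp only: M_scalar_right M_smult_left)
        (metis \<open>\<And>K. smult [:inverse c:] (smult [:c:] K) = K\<close> mult.commute smult_smult)
    then show "nc_divides A ?F G" by (auto simp: nc_divides_iff)
  qed
  have "?F \<noteq> 0" using assms by simp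
  moreover have "?F \<notin> Units A" using assms q_neq_1 by (auto simp: Units_iff)
  ultimately show ?thesis
    unfolding nc_prime_def by (simp add: div eval_u_M del: smult_pCons)
qed

lemma prime_u_factor:
  assumes F: "nc_prime A F" and H: "F = M H u"
  shows "\<exists>c. c \<noteq> 0 \<and> F = smult [:c:] u"
proof -
  have "u \<notin> Units A" using q_neq_1 by (auto simp: Units_iff)
  with prime_factor_unit[OF F H] obtain c where "c \<noteq> 0" "H = [:[:c:]:]"
    by (auto simp: Units_iff)
  with H show ?thesis by (metis M_const_left)
qed

section \<open>Primes when q is not a root of unity\<close>

lemma prime_dividesD:
  "nc_prime A F \<Longrightarrow> nc_divides A F (M G H) \<Longrightarrow> nc_divides A F G \<or> nc_divides A F H"
  by (simp add: nc_prime_def)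

lemma divides_degree:
  assumes "nc_divides A F G" "G \<noteq> 0"
  shows "degree F \<le> degree G"
    and "degree G = degree F \<Longrightarrow> \<exists>D. G = M F [:D:] \<or> G = M [:D:] F"
proof -
  obtain H where H: "G = M F H \<or> G = M H F" using assms by (auto simp: nc_divides_iff)
  then have "F \<noteq> 0" "H \<noteq> 0" using assms(2) by (auto simp: M_0_left)
  then have deg: "degree G = degree F + degree H"
    using H by (auto simp: degree_M)
  then show "degree F \<le> degree G" by simp
  show "\<exists>D. G = M F [:D:] \<or> G = M [:D:] F" if "degree G = degree F"
  proof -
    have "degree H = 0" using deg that by simp
    then obtain D where "H = [:D:]" by (rule degree_eq_zeroE)
    with H show ?thesis by blast
  qed
qed

lemma degree_0_swap_degree_0:
  assumes "degree F = 0" "degree (swap_poly F) = 0"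
  obtains c where "F = [:[:c:]:]"
proof -
  obtain P where P: "F = [:P:]" using assms(1) by (rule degree_eq_zeroE)
  have "coeff P j = 0" if "j > 0" for j
    using assms(2) that coeff_swap_const[of P j] P by (simp add: coeff_eq_0)
  then have "degree P \<le> 0" by (intro degree_le) simp
  then have "degree P = 0" by simp
  then obtain c where "P = [:c:]" by (rule degree_eq_zeroE)
  with P that show thesis by simp
qed

lemma smult_x_exhaust:
  assumes "\<And>j. coeff (coeff F j) 0 = 0"
  obtains G :: "'k poly poly" where "F = smult x G"
proof
  show "F = smult x (map_poly (poly_shift 1) F)"
    by (rule poly_poly_eqI)
      (use assms in \<open>auto simp: coeff_map_poly coeff_poly_shift coeff_pCons split: nat.split\<close>)
qed

text \<open>Left multiplication by \<open>y\<close> lowers the order of vanishing at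
  \<open>x = 0\<close> by at most one, through \<open>d\<close>.\<close>

lemma funpow_Y_monom_low:
  "l + i < N \<Longrightarrow> coeff (coeff ((Y ^^ i) [:monom 1 N:]) j) l = 0"
proof (induction i arbitrary: j l)
  case 0
  then show ?case by (auto simp: coeff_pCons split: nat.split)
next
  case (Suc i)
  then show ?case
    by (auto simp: coeff_Y coeff_qsigma coeff_qdelta q_neq_1 split: nat.split)
qed

lemma prime_degree_0_or_scalar_u:
  assumes q: "\<And>n. n > 0 \<Longrightarrow> q ^ n \<noteq> 1" and F: "nc_prime A F"
  shows "degree F = 0 \<or> (\<exists>c. c \<noteq> 0 \<and> F = smult [:c:] u)"
proof (cases "degree F = 0")
  case False
  define n where "n = degree F"
  \<comment> \<open>The exponent exceeds the degree in \<open>y\<close>, so after \<open>X\<close>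
    has passed all powers of \<open>y\<close> in \<open>F\<close> at least one \<open>x\<close>
    remains on the left.\<close>
  define X where "X = (monom 1 (Suc n) :: 'k poly)"
  have n: "n > 0" using False by (simp add: n_def)
  have F0: "F \<noteq> 0" and X0: "X \<noteq> 0" using F by (simp_all add: nc_prime_def X_def)
  have "coeff (coeff (M F [:X:]) j) 0 = 0" for j
    unfolding coeff_M coeff_sum X_def
    by (rule sum.neutral) (auto simp: coeff_mult_0 n_def intro!: funpow_Y_monom_low)
  then obtain G where G: "M F [:X:] = smult x G" by (rule smult_x_exhaust)
  have "G \<noteq> 0" using G F0 X0 by auto
  have "degree (M F [:X:]) = n" using F0 X0 by (simp add: degree_M n_def)
  then have degG: "degree G = n" using G by simp
  have lead: "coeff (M F [:X:]) n = lead_coeff F * smult (q ^ (n * Suc n)) X"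
  proof -
    have "(s ^^ n) X = smult (q ^ (n * Suc n)) X"
      by (rule poly_eqI) (auto simp: X_def coeff_funpow_qsigma)
    then show ?thesis using lead_coeff_M[of F "[:X:]"] by (simp add: n_def)
  qed
  have "nc_divides A F (M [:x:] G)"
    unfolding nc_divides_iff M_const_left G[symmetric] by blast
  moreover have "\<not> nc_divides A F [:x:]"
    using divides_degree(1)[of F "[:x:]"] n by (auto simp: n_def)
  ultimately have "nc_divides A F G"
    using prime_dividesD[OF F] by blast
  then obtain D where D: "G = M F [:D:] \<or> G = M [:D:] F"
    using divides_degree(2) \<open>G \<noteq> 0\<close> degG n_def by blast
  \<comment> \<open>Leading coefficients of \<open>F X = x G\<close> determine \<open>D\<close>. A
    cofactor on the right is itself twisted by \<open>s ^^ n\<close> and gives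
    \<open>r = q ^ n\<close>; one on the left gives \<open>r = q ^ (n * Suc n)\<close>.\<close>
  have "\<exists>r. r \<noteq> 1 \<and> x * D = smult r X"
    using D
  proof
    assume "G = M F [:D:]"
    then have "coeff (M F [:X:]) n = lead_coeff F * (x * (s ^^ n) D)"
      using lead_coeff_M[of F "[:D:]"] G by (simp add: n_def mult_ac)
    then have eq: "smult (q ^ (n * Suc n)) X = x * (s ^^ n) D"
      using lead F0 by (metis leading_coeff_0_iff mult_left_cancel)
    have "q ^ (n * j) * coeff (x * D) j = q ^ (n * j) * coeff (smult (q ^ n) X) j" for j
    proof (cases j)
      case (Suc k)
      have "q ^ (n * Suc n) * coeff X j = q ^ (n * k) * coeff D k"
        using arg_cong[OF eq, of "\<lambda>P. coeff P j"] Suc by (simp add: coeff_funpow_qsigma)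
      then have "q ^ n * (q ^ (n * k) * coeff D k) = q ^ n * (q ^ (n * Suc n) * coeff X j)"
        by simp
      then show ?thesis
        using Suc by (auto simp: X_def power_add mult_ac)
    qed (simp add: X_def)
    then have "x * D = smult (q ^ n) X"
      using q_nonzero by (intro poly_eqI) simp
    then show ?thesis using q[OF n] by blast
  next
    assume "G = M [:D:] F"
    then have "coeff (M F [:X:]) n = lead_coeff F * (x * D)"
      using G by (simp add: n_def mult_ac)
    then have "smult (q ^ (n * Suc n)) X = x * D"
      using lead F0 by (metis leading_coeff_0_iff mult_left_cancel)
    then show ?thesis using q[of "n * Suc n"] n by (metis mult_pos_pos zero_less_Suc)
  qed
  then obtain r where r: "r \<noteq> 1" "x * D = smult r X" by blast
  have eval_const: "eval_u [:P:] = to_fract P" for P by (simp add: eval_u_pCons)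
  \<comment> \<open>In the commutative image the side of \<open>D\<close> no longer matters, and
    \<open>r \<noteq> 1\<close> forces the image of \<open>F\<close> to vanish.\<close>
  have "eval_u F * to_fract X = eval_u F * to_fract (x * D)"
    using arg_cong[OF G, of eval_u] D
    by (auto simp: eval_u_M eval_u_smult eval_const to_fract_mult simp del: mult_pCons_left)
  also have "\<dots> = eval_u F * to_fract (smult r X)" by (simp only: r)
  finally have "eval_u F * (to_fract (X - smult r X)) = 0"
    by (simp only: to_fract_diff right_diff_distrib) simp
  moreover have "X - smult r X = smult (1 - r) X" by (simp add: smult_diff_left)
  ultimately have "eval_u F = 0" using r(1) X0 by simp
  then obtain K where "F = M K u" using eval_u_eq_0D by blast
  then show ?thesis using prime_u_factor[OF F] by blast
qed simp

lemma swap_u: "swap_poly (smult [:c:] u) = smult [:c:] u"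
  by (rule poly_poly_eqI) (auto simp: coeff_swap_poly coeff_pCons split: nat.split)

lemma prime_iff_scalar_u:
  assumes q: "\<And>n. n > 0 \<Longrightarrow> q ^ n \<noteq> 1"
  shows "nc_prime A F \<longleftrightarrow> (\<exists>c. c \<noteq> 0 \<and> F = smult [:c:] u)"
proof
  assume F: "nc_prime A F"
  \<comment> \<open>These are the degrees in \<open>y\<close> and in \<open>x\<close>; a nonzero
    element with both equal to zero is a scalar, hence a unit.\<close>
  have "degree F \<noteq> 0 \<or> degree (swap_poly F) \<noteq> 0"
  proof (rule ccontr)
    assume "\<not> ?thesis"
    then have "degree F = 0" "degree (swap_poly F) = 0" by simp_all
    then obtain c where c: "F = [:[:c:]:]" by (rule degree_0_swap_degree_0)
    then have "c \<noteq> 0" using F by (auto simp: nc_prime_def)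
    then have "F \<in> Units A" using c by (auto simp: Units_iff)
    then show False using F by (simp add: nc_prime_def)
  qed
  then show "\<exists>c. c \<noteq> 0 \<and> F = smult [:c:] u"
  proof
    assume "degree F \<noteq> 0"
    with prime_degree_0_or_scalar_u[OF q F] show ?thesis by simp
  next
    assume "degree (swap_poly F) \<noteq> 0"
    then obtain c where "c \<noteq> 0" and c: "swap_poly F = smult [:c:] u"
      using prime_degree_0_or_scalar_u[OF q swap_prime[OF F]] by auto
    moreover have "F = smult [:c:] u"
      using arg_cong[OF c, of swap_poly] by (simp only: swap_u swap_poly_swap_poly)
    ultimately show ?thesis by blast
  qed
next
  assume "\<exists>c. c \<noteq> 0 \<and> F = smult [:c:] u"
  then obtain c where "c \<noteq> 0" "F = smult [:c:] u" by blast
  then show "nc_prime A F" using prime_scalar_u[of c] by simp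
qed

text \<open>Commuting with \<open>y\<close> forces \<open>s P = P\<close> and
  \<open>d P = 0\<close>. Divisibility by the central \<open>P\<close> is coefficientwise, and
  irreducible polynomials over a field are prime, so \<open>dvd_coeff_M\<close> applies.\<close>

lemma central_const_prime:
  assumes P: "irreducible P" and central: "nc_central A [:P:]"
  shows "nc_prime A [:P:]"
proof -
  have "M [:P:] [:0, 1:] = M [:0, 1:] [:P:]"
    using central unfolding nc_central_def mult_qweyl carrier_qweyl by blast
  then have inv: "s P = P" "d P = 0"
    by (simp_all add: M_pCons_left M_0_left Y_const)
  have div: "nc_divides A [:P:] G \<longleftrightarrow> (\<forall>i. P dvd coeff G i)" for G
  proof -
    have "nc_divides A [:P:] G \<longleftrightarrow> (\<exists>H. G = smult P H)"
      using central by (auto simp: nc_divides_iff nc_central_def)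
    also have "\<dots> \<longleftrightarrow> [:P:] dvd G" by (auto simp: dvd_def)
    finally show ?thesis by (simp add: const_poly_dvd_iff)
  qed
  have "prime_elem P" using P by (rule field_poly_irreducible_imp_prime)
  then have "\<And>a b. P dvd a * b \<Longrightarrow> P dvd a \<or> P dvd b" by (rule prime_elem_dvd_multD)
  note dvd_coeff_M[OF inv this]
  moreover have "[:P:] \<notin> Units A" "P \<noteq> 0"
    using P by (auto simp: Units_iff irreducible_def is_unit_poly_iff dvd_field_iff)
  ultimately show ?thesis unfolding nc_prime_def by (auto simp: div)
qed

lemma swap_central: "nc_central A (swap_poly F) \<longleftrightarrow> nc_central A F"
  unfolding nc_central_def mult_qweyl carrier_qweyl by (metis UNIV_I swap_M swap_poly_swap_poly)

lemma central_swap_const_prime: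
  assumes "irreducible P" "nc_central A (swap_poly [:P:])"
  shows "nc_prime A (swap_poly [:P:])"
  using assms central_const_prime swap_prime swap_central by blast

text \<open>\<open>F\<close> divides \<open>x G\<close> but not \<open>x\<close>, by degree in
  \<open>y\<close>, so it divides \<open>G\<close>. The cofactor must be the scalar
  \<open>q\<close>, and the constant terms then give \<open>b = f * (q - 1)\<close>.\<close>

lemma prime_xy_affine_imp:
  assumes F: "nc_prime A F" and F_def: "F = [:[:f:], [:0, b:]:]"
  shows "F = smult [:f:] u \<and> f \<noteq> 0"
proof -
  \<comment> \<open>Obtained from \<open>F x = x G\<close> by rewriting \<open>y x\<close> as
    \<open>q x y + 1\<close>.\<close>
  define G where "G = [:[:b + f:], [:0, b * q:]:]"
  have b: "b \<noteq> 0"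
  proof
    assume "b = 0"
    with F_def F show False by (cases "f = 0") (auto simp: nc_prime_def Units_iff)
  qed
  have F0: "F \<noteq> 0" "degree F = 1" and G0: "G \<noteq> 0" "degree G = 1"
    using b q_nonzero by (simp_all add: F_def G_def)
  have "M F [:x:] = M [:x:] G"
    by (simp add: F_def G_def M_pCons_left M_0_left Y_x)
  then have "nc_divides A F (M [:x:] G)" unfolding nc_divides_iff by metis
  moreover have "\<not> nc_divides A F [:x:]"
    using divides_degree(1)[of F "[:x:]"] F0 by auto
  ultimately have "nc_divides A F G"
    using prime_dividesD[OF F] by blast
  then obtain D where D: "G = M F [:D:] \<or> G = M [:D:] F"
    using divides_degree(2) F0 G0 by metis
  have "D = [:q:] \<and> b + f = q * f"
    using D
  proof
    assume "G = M [:D:] F"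
    then have "[:b + f:] = smult f D" "[:0, b * q:] = [:0, b:] * D"
      by (simp_all add: F_def G_def mult.commute)
    moreover from this(2) have "smult b D = smult b [:q:]" by simp
    then have "D = [:q:]" using b by (metis smult_eq_iff)
    ultimately show ?thesis by (simp add: mult.commute)
  next
    assume "G = M F [:D:]"
    then have eq: "[:b + f:] = smult f D + pCons 0 (smult b (d D))" "[:0, b * q:] = [:0, b:] * s D"
      by (simp_all add: F_def G_def M_pCons_left M_0_left Y_const)
    from eq(2) have "smult b (s D) = smult b [:q:]" by simp
    then have "s D = [:q:]" using b by (metis smult_eq_iff)
    then have "(s ^^ 1) D = (s ^^ 1) [:q:]" by simp
    then have "D = [:q:]" by (simp only: qsigma_inj)
    with eq(1) show ?thesis by (simp add: mult.commute)
  qed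
  then have "b = f * (q - 1)" by (simp add: algebra_simps)
  with b show ?thesis by (simp add: F_def)
qed

end

section \<open>Central quadratic elements for q = -1\<close>

locale quantized_weyl_minus_one = quantized_weyl q for q :: "'k::field" +
  assumes q_eq: "q = - 1"
begin

lemma two_nonzero: "(2 :: 'k) \<noteq> 0"
  using q_neq_1 unfolding q_eq by (metis add_eq_0_iff one_add_one)

lemma coeff_s: "coeff (s P) n = (- 1) ^ n * coeff P n"
  by (simp add: coeff_qsigma q_eq)

lemma coeff_d: "coeff (d P) n = (if even n then coeff P (Suc n) else 0)"
proof -
  have "coeff (d P) n = ((- 1) ^ Suc n - 1) / (- 2) * coeff P (Suc n)"
    by (simp add: coeff_qdelta[OF q_neq_1], simp add: q_eq)
  then show ?thesis
    using two_nonzero by (cases "even n") simp_all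
qed

lemma qsigma_qsigma [simp]: "s (s P) = P"
  by (rule poly_eqI) (simp add: coeff_s flip: mult.assoc power_mult_distrib)

lemma degree_qsigma [simp]: "degree (s P) = degree P"
  unfolding qsigma_def using q_nonzero by (simp add: degree_pcompose)

section \<open>Factors of polynomials invariant under x -> -x\<close>

lemma dvd_qsigma_iff:
  assumes "p dvd s p"
  shows "p dvd s G \<longleftrightarrow> p dvd G"
  using assms qsigma_dvd_iff[of p G] qsigma_dvd_iff[of p "s G"] by (auto intro: dvd_trans)

text \<open>\<open>s p + p\<close> is twice the even part of \<open>p\<close>, here a constant;
  being divisible by the linear \<open>p\<close>, it is zero.\<close>

lemma linear_dvd_qsigma:
  assumes "degree p = 1" "p dvd s p"
  shows "coeff p 0 = 0"
proof -
  define a b where "a = coeff p 0" and "b = coeff p 1"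
  then have p: "p = [:a, b:]"
    using assms(1) by (auto intro!: poly_eqI simp: coeff_pCons coeff_eq_0 split: nat.split)
  have "s p + p = [:2 * a:]"
    by (rule poly_eqI) (auto simp: p coeff_s coeff_pCons split: nat.split)
  then have "p dvd [:2 * a:]"
    using assms(2) by (metis dvd_add dvd_refl)
  then have "2 * a = 0"
    using assms(1) dvd_imp_degree_le[of p "[:2 * a:]"] by fastforce
  then show ?thesis using two_nonzero p by simp
qed

text \<open>Applying \<open>s\<close> to \<open>E = p * R\<close> shows that \<open>p\<close>
  divides \<open>s p * s R\<close>, hence \<open>s R\<close>; thus \<open>s p\<close> divides
  \<open>R\<close>.\<close>

lemma qsigma_invariant_split:
  assumes p: "irreducible p" "\<not> p dvd s p" and E: "s E = E" "p dvd E"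
  obtains r where "E = p * s p * r" "s r = r"
proof -
  have pr: "prime_elem p" using p(1) by (rule field_poly_irreducible_imp_prime)
  have nz: "p * s p \<noteq> 0" using p(1) by auto
  obtain R where R: "E = p * R" using E(2) ..
  have "p dvd s p * s R" using E R by (metis \<sigma>_mult)
  then have "p dvd s R" using prime_elem_dvd_multD[OF pr] p(2) by blast
  then have "s p dvd R" using qsigma_dvd_iff[of p "s R"] by simp
  then obtain r where r: "R = s p * r" ..
  have "p * s p * s r = s E" by (simp add: R r \<sigma>_mult mult_ac)
  also have "\<dots> = p * s p * r" by (simp add: E(1)) (simp add: R r mult_ac)
  finally have "s r = r" using nz mult_left_cancel by blast
  moreover have "E = p * s p * r" using R r by (simp add: mult.assoc)
  ultimately show thesis using that by blast
qed

text \<open>Suppose each irreducible factor \<open>p\<close> with \<open>p dvd s p\<close> occurs at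
  least twice. It is not linear, as \<open>E\<close> does not vanish at 0, so \<open>E\<close> is a
  scalar times \<open>p * p\<close>. If there is no such factor, the factors pair off as
  \<open>p\<close> and \<open>s p\<close>. Both ways \<open>E\<close> is a norm up to a
  scalar.\<close>

lemma even_quartic_cases:
  assumes E: "s E = E" "degree E = 4" "coeff E 0 \<noteq> 0"
  obtains (norm) h k where "degree h = 2" "E = smult k (h * s h)"
    | (simple) p where "irreducible p" "p dvd s p" "p dvd E" "\<not> p * p dvd E"
proof (rule ccontr)
  assume neg: "\<not> thesis"
  have square: "p * p dvd E" if "irreducible p" "p dvd s p" "p dvd E" for p
    using simple neg that by blast
  have no_norm: "E \<noteq> smult k (h * s h)" if "degree h = 2" for h k
    using norm neg that by blast
  have E0: "E \<noteq> 0" using E(3) by auto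
  have linear: "\<not> p dvd s p" if "p dvd E" "degree p = 1" for p
    using linear_dvd_qsigma[OF that(2)] that(1) E(3) by (auto simp: coeff_mult_0)
  have pos: "degree p > 0" if "irreducible p" for p :: "'k poly"
    using that degree_pos_iff_nonunit by (auto simp: irreducible_def)
  obtain p where p: "irreducible p" "p dvd E"
    using exists_irreducible_factor[of E] E(2) by auto
  note pos_p = pos[OF p(1)]
  show False
  proof (cases "p dvd s p")
    case True
    then obtain r where r: "E = p * p * r" using square p by (auto elim: dvdE)
    have "p \<noteq> 0" "r \<noteq> 0" using r E0 by auto
    then have "4 = 2 * degree p + degree r"
      using E(2) r by (simp add: degree_mult_eq)
    moreover have "degree p \<noteq> 1" using linear p(2) True by blast
    ultimately have "degree p = 2" "degree r = 0" using pos_p by presburger+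
    obtain k where k: "r = [:k:]" using \<open>degree r = 0\<close> by (rule degree_eq_zeroE)
    obtain t where t: "s p = p * t" using True ..
    then have "t \<noteq> 0" using \<open>p \<noteq> 0\<close> by auto
    moreover have "degree p = degree p + degree t"
      using t \<open>p \<noteq> 0\<close> \<open>t \<noteq> 0\<close> by (metis degree_mult_eq degree_qsigma)
    then have "degree t = 0" by simp
    then obtain m where m: "t = [:m:]" by (rule degree_eq_zeroE)
    \<comment> \<open>Here \<open>s p\<close> is \<open>p\<close> times the scalar \<open>m\<close>,
      so the square of \<open>p\<close> is already a norm up to a scalar.\<close>
    ultimately have "E = smult (k / m) (p * s p)"
      by (simp add: r k t mult.assoc)
    then show False using no_norm \<open>degree p = 2\<close> by blast
  next
    case False
    obtain r where r: "E = p * s p * r" "s r = r"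
      using qsigma_invariant_split[OF p(1) False E(1) p(2)] .
    have nz: "p \<noteq> 0" "r \<noteq> 0" using r E0 by auto
    then have deg: "4 = 2 * degree p + degree r"
      using E(2) r by (simp add: degree_mult_eq)
    have "degree r \<noteq> 0"
    proof
      assume "degree r = 0"
      then obtain k where "r = [:k:]" by (rule degree_eq_zeroE)
      then have "E = smult k (p * s p)" using r by simp
      then show False using no_norm deg \<open>degree r = 0\<close> by simp
    qed
    then have deg1: "degree p = 1" "degree r = 2" using deg pos_p by presburger+
    obtain l where l: "irreducible l" "l dvd r"
      using exists_irreducible_factor[of r] deg1 by auto
    have "l dvd E" using l r by simp
    show False
    proof (cases "l dvd s l")
      case True
      \<comment> \<open>Such an \<open>l\<close> has degree 2 and exhausts \<open>r\<close> up to a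
        scalar, so its second copy would have to divide one of the linear \<open>p\<close> and
        \<open>s p\<close>.\<close>
      then obtain t where t: "E = l * l * t" using square l \<open>l dvd E\<close> by (auto elim: dvdE)
      obtain w where w: "r = l * w" using l(2) ..
      have lw: "l \<noteq> 0" "w \<noteq> 0" using w nz by auto
      then have "2 = degree l + degree w" using deg1(2) w by (simp add: degree_mult_eq)
      moreover have "degree l \<noteq> 1" using linear \<open>l dvd E\<close> True by blast
      ultimately have dl: "degree l = 2" "degree w = 0" using pos[OF l(1)] by presburger+
      have "l * (p * s p * w) = l * (l * t)" using t r w by (simp add: mult_ac)
      then have "p * s p * w = l * t" using lw(1) mult_left_cancel by blast
      then have "l dvd p * s p * w" by simp
      then have "l dvd p \<or> l dvd s p \<or> l dvd w"
        using prime_elem_dvd_multD[OF field_poly_irreducible_imp_prime[OF l(1)]] by blast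
      then show False
        using dvd_imp_degree_le[of l p] dvd_imp_degree_le[of l "s p"] dvd_imp_degree_le[of l w]
          dl deg1 nz lw by auto
    next
      case False
      obtain t where t: "r = l * s l * t"
        using qsigma_invariant_split[OF l(1) False r(2) l(2)] .
      have lt: "l \<noteq> 0" "t \<noteq> 0" using t nz by auto
      then have "2 = 2 * degree l + degree t" using deg1(2) t by (simp add: degree_mult_eq)
      then have dl: "degree l = 1" "degree t = 0" using pos[OF l(1)] by presburger+
      obtain k where k: "t = [:k:]" using dl(2) by (rule degree_eq_zeroE)
      have "degree (p * l) = 2" using nz lt deg1 dl by (simp add: degree_mult_eq)
      moreover have "E = smult k (p * l * s (p * l))"
        by (simp add: r(1) t k \<sigma>_mult mult_ac)
      ultimately show False using no_norm by blast
    qed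
  qed
qed

text \<open>Infinite descent on the multiplicity of \<open>p\<close>, which is even on the left and odd on the right.\<close>

lemma norm_descent:
  assumes p: "irreducible p" "p dvd s p" "p dvd E" "\<not> p * p dvd E" and c: "c \<noteq> 0"
    and eq: "smult c (G * s G) = E * (Q * s Q)"
  shows "G = 0 \<and> Q = 0"
  using eq
proof (induction "degree Q" arbitrary: G Q rule: less_induct)
  case less
  note pr = prime_elem_dvd_multD[OF field_poly_irreducible_imp_prime[OF p(1)]]
  have p0: "p \<noteq> 0" using p(1) by auto
  have E0: "E \<noteq> 0" using p(4) by auto
  have pnorm: "p dvd G" if "p dvd G * s G" for G
    using pr[OF that] dvd_qsigma_iff[OF p(2)] by blast
  have Q0: "Q = 0"
  proof (rule ccontr)
    assume Q: "Q \<noteq> 0"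
    have "p dvd smult c (G * s G)" unfolding less.prems using p(3) by simp
    then have "p dvd G * s G" using c by (simp add: dvd_smult_iff)
    then have "p dvd G" by (rule pnorm)
    then obtain G' where G': "G = p * G'" ..
    obtain E' where E': "E = p * E'" using p(3) ..
    have "p dvd s G" using \<open>p dvd G\<close> dvd_qsigma_iff[OF p(2)] by blast
    then have "p * p dvd smult c (G * s G)"
      using \<open>p dvd G\<close> by (intro dvd_smult mult_dvd_mono)
    also have "\<dots> = p * (E' * (Q * s Q))" unfolding less.prems by (simp add: E' mult.assoc)
    finally have "p dvd E' * (Q * s Q)" using p0 by simp
    moreover have "\<not> p dvd E'" using p(4) p0 by (simp add: E')
    ultimately have "p dvd Q * s Q" using pr by blast
    then have "p dvd Q" by (rule pnorm)
    then obtain Q' where Q': "Q = p * Q'" ..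
    have "(p * s p) * smult c (G' * s G') = smult c (G * s G)"
      by (simp add: G' \<sigma>_mult mult_ac)
    also have "\<dots> = (p * s p) * (E * (Q' * s Q'))"
      unfolding less.prems by (simp add: Q' \<sigma>_mult mult_ac)
    finally have eq': "smult c (G' * s G') = E * (Q' * s Q')"
      by (rule mult_left_cancel[THEN iffD1, rotated]) (use p0 in simp)
    have "degree p > 0" using p(1) degree_pos_iff_nonunit by (auto simp: irreducible_def)
    moreover have "Q' \<noteq> 0" using Q Q' by auto
    ultimately have "degree Q' < degree Q" using Q' p0 by (simp add: degree_mult_eq)
    from less.hyps[OF this eq'] \<open>Q' \<noteq> 0\<close> show False by simp
  qed
  then have "G * s G = 0" using less.prems c by simp
  with Q0 show ?case by simp
qed

section \<open>The central quadratic element: division and reduced norm\<close>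

definition quad :: "'k \<Rightarrow> 'k \<Rightarrow> 'k \<Rightarrow> 'k poly poly" where
  "quad a c f = [:[:f, 0, a:], 0, [:c:]:]"

lemma Y_quad: "Y (quad a c f) = pCons 0 (quad a c f)"
  by (rule poly_poly_eqI)
    (auto simp: quad_def coeff_Y coeff_s coeff_d coeff_pCons split: nat.split)

text \<open>\<open>y^2\<close> commutes with \<open>k[x]\<close> because \<open>d\<close> squares to
  zero and anticommutes with \<open>s\<close>.\<close>

lemma Y_Y_const: "Y (Y [:P:]) = [:0, 0, P:]"
proof -
  have "d (d P) = 0"
    by (rule poly_eqI) (simp add: coeff_d)
  moreover have "s (d P) + d (s P) = 0"
    by (rule poly_eqI) (simp add: coeff_d coeff_s)
  moreover have "Y [:A, B:] = [:d A, s A + d B, s B:]" for A B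
    by (rule poly_eqI) (auto simp: coeff_Y coeff_pCons split: nat.split)
  ultimately show ?thesis by (simp add: Y_const)
qed

text \<open>Since \<open>y\<close> commutes with \<open>quad a c f\<close>, multiplying by it is the
  commutative product of \<open>k[x][y]\<close>, which makes ordinary \<open>dvd\<close>
  available.\<close>

lemma M_quad_right: "M h (quad a c f) = h * quad a c f"
proof (induction h)
  case 0
  show ?case by (simp add: M_0_left)
next
  case (pCons P h)
  then show ?case by (simp add: M_pCons_left Y_quad M_pCons_0_right)
qed

lemma M_quad_left: "M (quad a c f) h = h * quad a c f"
proof (induction h)
  case 0
  show ?case by simp
next
  case (pCons P h)
  have "M (quad a c f) [:P:] = smult P (quad a c f)"
    by (simp add: quad_def M_pCons_left M_0_left Y_Y_const mult.commute)
  moreover have "pCons P h = [:P:] + pCons 0 h" by simp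
  ultimately have "M (quad a c f) (pCons P h) = smult P (quad a c f) + pCons 0 (h * quad a c f)"
    by (simp only: M_add_right M_pCons_0_right pCons.IH)
  then show ?case by simp
qed

lemma quad_central: "nc_central A (quad a c f)"
  by (simp add: nc_central_def M_quad_left M_quad_right)

lemma quad_divides_iff: "nc_divides A (quad a c f) G \<longleftrightarrow> quad a c f dvd G"
  by (auto simp: nc_divides_iff M_quad_left M_quad_right dvd_def mult.commute)

lemma quad_dvd_M:
  assumes "quad a c f dvd G"
  shows "quad a c f dvd M H G" "quad a c f dvd M G H"
proof -
  from assms obtain K where "G = M K (quad a c f)" "G = M (quad a c f) K"
    by (auto simp: M_quad_left M_quad_right dvd_def mult.commute)
  then have "M H G = M (M H K) (quad a c f)" "M G H = M (quad a c f) (M K H)"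
    by (metis M_assoc)+
  then show "quad a c f dvd M H G" "quad a c f dvd M G H"
    by (simp_all add: M_quad_left M_quad_right)
qed

text \<open>Division with remainder in \<open>y\<close>: the leading coefficient \<open>c\<close> is
  a unit of \<open>k[x]\<close>.\<close>

lemma quad_remainder:
  assumes "c \<noteq> 0"
  shows "\<exists>h P Q. g = h * quad a c f + [:P, Q:]"
proof (induction g)
  case 0
  show ?case by (rule exI[of _ 0], rule exI[of _ 0], rule exI[of _ 0]) simp
next
  case (pCons R g)
  then obtain h P Q where g: "g = h * quad a c f + [:P, Q:]" by blast
  define t where "t = smult (inverse c) Q"
  have "smult c t = Q" using assms by (simp add: t_def)
  then have "[:R, P, Q:] = smult t (quad a c f) + [:R - t * [:f, 0, a:], P:]"
    by (simp add: quad_def)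
  moreover have "pCons R g = pCons 0 h * quad a c f + [:R, P, Q:]"
    by (simp add: g)
  ultimately have "pCons R g = pCons t h * quad a c f + [:R - t * [:f, 0, a:], P:]"
    by (simp add: algebra_simps)
  then show ?case by blast
qed

lemma quad_dvd_smult_linear:
  assumes "c \<noteq> 0" "N \<noteq> 0" "quad a c f dvd smult N [:P, Q:]"
  shows "[:P, Q:] = 0"
proof (rule ccontr)
  assume nz: "[:P, Q:] \<noteq> 0"
  then have "degree (quad a c f) \<le> degree (smult N [:P, Q:])"
    using assms by (intro dvd_imp_degree_le) auto
  moreover have "degree (smult N [:P, Q:]) \<le> 1" by (rule order.trans[OF degree_smult_le]) simp
  moreover have "degree (quad a c f) = 2" using assms(1) by (simp add: quad_def)
  ultimately show False by simp
qed

text \<open>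
  The left factor below is the conjugate of \<open>P + Q y\<close> under the involution \<open>x \<mapsto> - x\<close>,
  \<open>y \<mapsto> - y\<close>; the constant term on the right is the reduced norm modulo \<open>quad a c f\<close>.
\<close>

lemma conjugate_product:
  fixes P Q :: "'k poly"
  assumes "c \<noteq> 0"
  defines "k \<equiv> smult (inverse c) (Q * s Q)"
  shows "M [:s P + d Q, - Q:] [:P, Q:]
    = [:(s P + d Q) * P - Q * d P + k * [:f, 0, a:]:] - smult k (quad a c f)"
proof -
  have "smult c k = Q * s Q" using assms by simp
  moreover have "Y [:P, Q:] = [:d P, s P + d Q, s Q:]"
    by (rule poly_eqI) (auto simp: coeff_Y coeff_pCons split: nat.split)
  ultimately show ?thesis
    by (simp add: M_pCons_left M_0_left quad_def algebra_simps)
qed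

text \<open>The substitution \<open>G = T P + Q\<close> diagonalizes the norm form: multiplying the
  norm by \<open>T\<^sup>2\<close> eliminates \<open>dP\<close> and \<open>dQ\<close>.\<close>

lemma norm_identity:
  fixes C T V P Q sP sQ dP dQ :: "'r::comm_ring_1"
  assumes "T * dP = P - sP" "T * dQ = Q - sQ" "C * ((sP + dQ) * P - Q * dP) + Q * sQ * V = 0"
  shows "C * ((T * P + Q) * (- T * sP + sQ)) = (C + T\<^sup>2 * V) * (Q * sQ)"
proof -
  have "(C + T\<^sup>2 * V) * (Q * sQ) - C * ((T * P + Q) * (- T * sP + sQ))
      = T\<^sup>2 * (C * ((sP + dQ) * P - Q * dP) + Q * sQ * V)
        - T * C * P * (T * dQ - (Q - sQ)) + T * C * Q * (T * dP - (P - sP))"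
    by (simp add: algebra_simps power2_eq_square)
  also have "\<dots> = 0" by (simp only: assms) simp
  finally show ?thesis by simp
qed

lemma norm_nonzero:
  assumes c: "c \<noteq> 0" and E: "E = [:c, 0, 4 * f, 0, 4 * a:]"
    and p: "irreducible p" "p dvd s p" "p dvd E" "\<not> p * p dvd E"
    and norm: "(s P + d Q) * P - Q * d P + smult (inverse c) (Q * s Q) * [:f, 0, a:] = 0"
  shows "P = 0 \<and> Q = 0"
proof -
  \<comment> \<open>\<open>T\<close> is \<open>(1 - q) x\<close>, the negative of the denominator in
    \<open>d\<close>.\<close>
  define T where "T = [:0, 2 :: 'k:]"
  have d: "T * d R = R - s R" for R
    by (rule poly_eqI) (auto simp: T_def coeff_s coeff_d coeff_pCons split: nat.split)
  have "[:c:] * ((s P + d Q) * P - Q * d P) + Q * s Q * [:f, 0, a:]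
      = smult c ((s P + d Q) * P - Q * d P + smult (inverse c) (Q * s Q) * [:f, 0, a:])"
    using c by (simp add: smult_add_right del: mult_pCons_right)
  then have "[:c:] * ((s P + d Q) * P - Q * d P) + Q * s Q * [:f, 0, a:] = 0"
    by (simp only: norm smult_0_right)
  note norm_identity[OF d d this]
  moreover have "[:c:] + T\<^sup>2 * [:f, 0, a:] = E"
    by (simp add: E T_def power2_eq_square)
  moreover have "s (T * P + Q) = - T * s P + s Q"
  proof -
    have "s T = - T"
      by (rule poly_eqI) (auto simp: T_def coeff_s coeff_pCons split: nat.split)
    then show ?thesis by (simp only: \<sigma>_add \<sigma>_mult)
  qed
  ultimately have "smult c ((T * P + Q) * s (T * P + Q)) = E * (Q * s Q)"
    by simp
  then have "T * P + Q = 0" "Q = 0"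
    using norm_descent[OF p c] by blast+
  moreover have "T \<noteq> 0" using two_nonzero by (simp add: T_def)
  ultimately show ?thesis by simp
qed

text \<open>Reduce \<open>b\<close> to \<open>P + Q y\<close> and multiply by the conjugate on the
  left: this turns \<open>b\<close> into its norm \<open>N\<close> in \<open>k[x]\<close>. If
  \<open>N\<close> is nonzero, the degree in \<open>y\<close> shows that the remainder of
  \<open>g\<close> vanishes.\<close>

lemma quad_dvd_M_cases:
  assumes c: "c \<noteq> 0" and E: "E = [:c, 0, 4 * f, 0, 4 * a:]"
    and p: "irreducible p" "p dvd s p" "p dvd E" "\<not> p * p dvd E"
    and dvd: "quad a c f dvd M b g"
  shows "quad a c f dvd b \<or> quad a c f dvd g"
proof -
  let ?F = "quad a c f"
  obtain h P Q where b: "b = h * ?F + [:P, Q:]" using quad_remainder[OF c] by blast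
  obtain h' P' Q' where g: "g = h' * ?F + [:P', Q':]" using quad_remainder[OF c] by blast
  define k where "k = smult (inverse c) (Q * s Q)"
  define N where "N = (s P + d Q) * P - Q * d P + k * [:f, 0, a:]"
  show ?thesis
  proof (cases "N = 0")
    case True
    then have "P = 0 \<and> Q = 0"
      using norm_nonzero[OF c E p] unfolding N_def k_def by blast
    then show ?thesis using b by simp
  next
    case False
    have red: "?F dvd M V W" if "?F dvd M U W" "?F dvd U - V" for U V W
    proof -
      have "M U W = M (U - V) W + M V W" by (simp flip: M_add_left)
      then show ?thesis using that quad_dvd_M(2)[of a c f "U - V" W] by (metis dvd_add_right_iff)
    qed
    have "?F dvd M [:P, Q:] g"
      by (rule red[OF dvd]) (simp add: b)
    then have "?F dvd M (M [:s P + d Q, - Q:] [:P, Q:]) g"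
      unfolding M_assoc by (rule quad_dvd_M(1))
    then have "?F dvd M [:N:] g"
    proof (rule red)
      have "M [:s P + d Q, - Q:] [:P, Q:] = [:N:] - smult k ?F"
        unfolding N_def k_def by (rule conjugate_product[OF c])
      then show "?F dvd M [:s P + d Q, - Q:] [:P, Q:] - [:N:]"
        by (simp only:) (simp add: dvd_smult)
    qed
    then have "?F dvd smult N (h' * ?F) + smult N [:P', Q':]"
      unfolding M_const_left g smult_add_right .
    moreover have "?F dvd smult N (h' * ?F)" by (intro dvd_smult) simp
    ultimately have "?F dvd smult N [:P', Q':]" using dvd_add_right_iff by blast
    then have "[:P', Q':] = 0" using quad_dvd_smult_linear[OF c False] by blast
    then show ?thesis using g by simp
  qed
qed

text \<open>As \<open>x y + y x = 1\<close>, the square of \<open>h2 x + 2 h0 y\<close> has no mixed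
  term, only the extra constant \<open>2 h0 h2\<close>. The product is a difference of squares,
  matched with the coefficients of the quartic.\<close>

lemma quad_factorization:
  assumes "[:c, 0, 4 * f, 0, 4 * a:] = smult k ([:h0, h1, h2:] * s [:h0, h1, h2:])"
  shows "quad a c f = M (smult [:k / 4:] [:[:h1, h2:], [:2 * h0:]:]) [:[:- h1, h2:], [:2 * h0:]:]"
proof -
  have four: "(4 :: 'k) \<noteq> 0" using two_nonzero by (metis mult_eq_0_iff numeral_Bit0 mult_2)
  have "s [:h0, h1, h2:] = [:h0, - h1, h2:]"
    by (rule poly_eqI) (auto simp: coeff_s coeff_pCons split: nat.split)
  with assms have "c = k * h0 * h0" "4 * f = k * (2 * h0 * h2 - h1 * h1)" "4 * a = k * h2 * h2"
    by (simp_all add: algebra_simps)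
  then have k: "h0 * (h0 * k) = c" "(2 * h0 * h2 - h1 * h1) * k = f * 4" "h2 * h2 * k = a * 4"
    by (simp_all add: mult_ac)
  have "Y [:[:- h1, h2:], [:2 * h0:]:] = [:[:h2:], [:- h1, - h2:], [:2 * h0:]:]"
    by (rule poly_poly_eqI)
      (auto simp: coeff_Y coeff_s coeff_d coeff_pCons split: nat.split)
  then have "M [:[:h1, h2:], [:2 * h0:]:] [:[:- h1, h2:], [:2 * h0:]:]
      = quad (h2 * h2) (4 * h0 * h0) (2 * h0 * h2 - h1 * h1)"
    by (simp add: M_pCons_left M_0_left quad_def algebra_simps)
  then show ?thesis
    by (simp only: M_smult_left) (simp add: quad_def four k)
qed

lemma irreducible_if_nc_irreducible:
  assumes "nc_irreducible A [:P:]"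
  shows "irreducible P"
proof (rule irreducibleI)
  have nonunit: "[:P:] \<notin> Units A" using assms by (simp add: nc_irreducible_def)
  have factor: "[:g:] \<in> Units A \<or> [:h:] \<in> Units A" if "P = g * h" for g h
  proof -
    have "[:P:] = M [:g:] [:h:]" using that by simp
    then show ?thesis using assms by (simp add: nc_irreducible_def del: M_const_left)
  qed
  have unit: "is_unit g \<longleftrightarrow> [:g:] \<in> Units A" for g
    by (auto simp: Units_iff is_unit_poly_iff dvd_field_iff)
  show "P \<noteq> 0" using factor[of 0 0] by (auto simp: Units_iff)
  show "\<not> is_unit P" using nonunit unit by blast
  show "is_unit g \<or> is_unit h" if "P = g * h" for g h
    using factor[OF that] unit by blast
qed

lemma quad_const_irreducible_imp_prime:
  assumes "nc_irreducible A (quad a 0 f)"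
  shows "nc_prime A (quad a 0 f)"
proof -
  have "quad a 0 f = [:[:f, 0, a:]:]" by (simp add: quad_def)
  with assms show ?thesis
    using central_const_prime irreducible_if_nc_irreducible quad_central by metis
qed

lemma quad_irreducible_imp_prime:
  assumes irr: "nc_irreducible A (quad a c f)"
  shows "nc_prime A (quad a c f)"
proof -
  consider "c = 0" | "a = 0" | "a \<noteq> 0" "c \<noteq> 0" by blast
  then show ?thesis
  proof cases
    case 1
    with irr show ?thesis using quad_const_irreducible_imp_prime by simp
  next
    case 2
    \<comment> \<open>Exchanging the variables reduces a polynomial in \<open>y\<close> to one in
      \<open>x\<close>.\<close>
    have "swap_poly (quad 0 c f) = quad c 0 f"
      by (rule poly_poly_eqI) (auto simp: coeff_swap_poly quad_def coeff_pCons split: nat.split)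
    then show ?thesis
      using irr swap_irreducible quad_const_irreducible_imp_prime swap_prime 2
      by (metis swap_poly_swap_poly)
  next
    case 3
    let ?E = "[:c, 0, 4 * f, 0, 4 * a:]"
    have four: "(4 :: 'k) \<noteq> 0" using two_nonzero by (metis mult_eq_0_iff numeral_Bit0 mult_2)
    have "s ?E = ?E"
      by (rule poly_eqI) (auto simp: coeff_s coeff_pCons split: nat.split)
    moreover have "degree ?E = 4" using 3 four by simp
    moreover have "coeff ?E 0 \<noteq> 0" using 3 by simp
    ultimately show ?thesis
    proof (cases rule: even_quartic_cases)
      case (norm h k)
      define h0 h1 h2 where "h0 = coeff h 0" and "h1 = coeff h 1" and "h2 = coeff h 2"
      have "h = [:h0, h1, h2:]"
        using norm(1)
        by (auto intro!: poly_eqI simp: h0_def h1_def h2_def coeff_pCons coeff_eq_0 numeral_2_eq_2 split: nat.split)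
      then have E: "?E = smult k ([:h0, h1, h2:] * s [:h0, h1, h2:])" using norm(2) by simp
      \<comment> \<open>This coefficient is \<open>c\<close>, so \<open>h0\<close> is nonzero; both
        linear factors then involve \<open>y\<close> and are not units.\<close>
      have "coeff ?E 0 = k * h0 * h0"
        by (subst E) (simp add: coeff_mult_0 coeff_qsigma)
      then have nz: "k \<noteq> 0" "h0 \<noteq> 0" using 3 by auto
      let ?L = "smult [:k / 4:] [:[:h1, h2:], [:2 * h0:]:]" and ?R = "[:[:- h1, h2:], [:2 * h0:]:]"
      have "?L \<in> Units A \<or> ?R \<in> Units A"
        using irr quad_factorization[OF E] unfolding nc_irreducible_def mult_qweyl carrier_qweyl
        by blast
      then have False using nz four two_nonzero by (auto simp: Units_iff)
      then show ?thesis ..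
    next
      case (simple p)
      have "quad a c f \<noteq> 0" using 3 by (simp add: quad_def)
      moreover have "quad a c f \<notin> Units A" using irr by (simp add: nc_irreducible_def)
      ultimately show ?thesis
        using quad_dvd_M_cases[OF 3(2) refl simple]
        unfolding nc_prime_def mult_qweyl carrier_qweyl zero_qweyl quad_divides_iff by blast
    qed
  qed
qed

end

section \<open>Coefficient form of the elements in the theorem\<close>

lemma qw_x_eq: "qw_x = [:[:0, 1::'k::field:]:]"
  and qw_y_eq: "qw_y = [:0, 1 :: 'k poly:]"
  by (simp_all add: qw_x_def qw_of_x_def qw_y_def qw_of_y_def map_poly_pCons one_pCons)

context quantized_weyl
begin

lemma M_const_x_y: "M (qw_const b) (M qw_x qw_y) = [:0, [:0, b:]:]"
  by (simp add: qw_const_def qw_x_eq qw_y_eq)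

lemma qw_u_eq: "qw_u q = u"
  by (simp add: qw_u_def M_const_x_y one_pCons)

lemma M_const_qw_u: "M (qw_const c) (qw_u q) = smult [:c:] u"
  by (simp add: qw_u_eq qw_const_def)

lemma qw_of_y_eq: "qw_of_y P = swap_poly [:P:]"
  by (rule poly_eqI) (simp add: qw_of_y_def coeff_map_poly coeff_swap_const)

lemma M_quadratic:
  "M (qw_const a) (M qw_x qw_x) + M (qw_const c) (M qw_y qw_y) + qw_const f
    = [:[:f, 0, a:], 0, [:c:]:]"
proof -
  have "Y qw_y = [:0, 0, 1:]"
    by (rule poly_eqI) (auto simp: qw_y_eq coeff_Y coeff_pCons split: nat.split)
  then have "M qw_y qw_y = [:0, 0, 1:]"
    by (simp add: qw_y_eq M_pCons_left M_0_left M_1_left flip: one_pCons)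
  then show ?thesis by (simp add: qw_const_def qw_x_eq)
qed

end

theorem theorem12:
  fixes q :: "'k::field"
  assumes "CHAR('k) \<noteq> 2" and "q \<noteq> 0" and "q \<noteq> 1"
  defines "A \<equiv> qweyl q"
  shows
    "((\<forall>n>0. q ^ n \<noteq> 1) \<longrightarrow>
        (\<forall>F\<in>carrier A. nc_prime A F \<longleftrightarrow> (\<exists>c. c \<noteq> 0 \<and> F = qw_const c \<otimes>\<^bsub>A\<^esub> qw_u q)))
     \<and> (\<forall>P :: 'k poly. irreducible P \<longrightarrow>
          (nc_central A (qw_of_x P) \<longrightarrow> nc_prime A (qw_of_x P)) \<and>
          (nc_central A (qw_of_y P) \<longrightarrow> nc_prime A (qw_of_y P)))
     \<and> (\<forall>a b c f :: 'k.
          (let F = qw_const b \<otimes>\<^bsub>A\<^esub> (qw_x \<otimes>\<^bsub>A\<^esub> qw_y) \<oplus>\<^bsub>A\<^esub> qw_const f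
           in nc_prime A F \<longleftrightarrow> F = qw_const f \<otimes>\<^bsub>A\<^esub> qw_u q \<and> f \<noteq> 0) \<and>
          (let F = qw_const a \<otimes>\<^bsub>A\<^esub> (qw_x \<otimes>\<^bsub>A\<^esub> qw_x) \<oplus>\<^bsub>A\<^esub> qw_const c \<otimes>\<^bsub>A\<^esub> (qw_y \<otimes>\<^bsub>A\<^esub> qw_y)
                 \<oplus>\<^bsub>A\<^esub> qw_const f
           in q = -1 \<longrightarrow> (nc_prime A F \<longleftrightarrow> nc_irreducible A F)))"
proof -
  interpret quantized_weyl q using assms(2,3) by unfold_locales
  have F1: "qw_const b \<otimes>\<^bsub>A\<^esub> (qw_x \<otimes>\<^bsub>A\<^esub> qw_y) \<oplus>\<^bsub>A\<^esub> qw_const f = [:[:f:], [:0, b:]:]" for b f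
    by (simp only: A_def mult_qweyl add_qweyl M_const_x_y) (simp add: qw_const_def)
  have F2: "qw_const a \<otimes>\<^bsub>A\<^esub> (qw_x \<otimes>\<^bsub>A\<^esub> qw_x) \<oplus>\<^bsub>A\<^esub> qw_const c \<otimes>\<^bsub>A\<^esub> (qw_y \<otimes>\<^bsub>A\<^esub> qw_y)
      \<oplus>\<^bsub>A\<^esub> qw_const f = [:[:f, 0, a:], 0, [:c:]:]" for a c f
    unfolding A_def mult_qweyl add_qweyl by (rule M_quadratic)
  have cu: "qw_const c \<otimes>\<^bsub>A\<^esub> qw_u q = smult [:c:] u" for c
    unfolding A_def mult_qweyl by (rule M_const_qw_u)
  have part3a: "nc_prime A [:[:f:], [:0, b:]:] \<longleftrightarrow> [:[:f:], [:0, b:]:] = smult [:f:] u \<and> f \<noteq> 0" for b f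
    unfolding A_def using prime_xy_affine_imp prime_scalar_u by metis
  have part3b: "nc_prime A [:[:f, 0, a:], 0, [:c:]:] \<longleftrightarrow> nc_irreducible A [:[:f, 0, a:], 0, [:c:]:]"
    if "q = - 1" for a c f
  proof -
    interpret quantized_weyl_minus_one q using that by unfold_locales
    show ?thesis
      unfolding A_def using prime_imp_irreducible quad_irreducible_imp_prime quad_def by metis
  qed
  show ?thesis
    unfolding F1 F2 cu Let_def
    using prime_iff_scalar_u central_const_prime central_swap_const_prime part3a part3b
    by (auto simp: A_def qw_of_y_eq qw_of_x_def)
qed

end
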